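(* There are quantities $o(1)$, tending to $0$ as $n\to\infty$ and independent of $k$ and $\delta$, such that the following hold for the spectral gap $\mathrm{gap}(n,k)$ of a single card in the overlapping-cycles shuffle with parameters $n$ and $k$. (i) For any integer $k\in[1,n)$, we have $\mathrm{gap}(n,k)\le (2\pi^2+o(1))\,n^{-3/2}$. (ii) For any integer $k\in[1,n)$, we have $\mathrm{gap}(n,k)\ge (4\pi^2+o(1))\,n^{-3}$. (iii) For almost all values of $k\in[1,n)$, $\mathrm{gap}(n,k)$ is of order $n^{-3/2}$. More precisely, when $n$ is large enough, for any $\delta>0$, for all but at most $\delta^{2/3}n$ integers $k\in[1,n)$, we have $\mathrm{gap}(n,k)\ge(\pi^2/16+o(1))\,\delta\, n^{-3/2}$.
   Context: Let $n$ and $k$ be integers with $1\le k<n$. The overlapping-cycles shuffle with parameters $n,k$ acts on a deck of $n$ cards: at each step a fair coin is flipped to decide whether to move the card in position $n$ or the card in position $n-k$ to the top of the deck (position $1$). The position of a single card is a Markov chain on $\{1,\dots,n\}$ with the following transitions: from $i\in[1,n-k-1]$ to $i+1$ with probability $1$; from $n-k$ to $1$ or to $n-k+1$, each with probability $1/2$; from $i\in[n-k+1,n-1]$ to $i$ or to $i+1$, each with probability $1/2$; from $n$ to $1$ or to $n$, each with probability $1/2$. $\mathrm{gap}(n,k)$ denotes the spectral gap of this single-card chain, i.e. $1-\max|\lambda|$, where the maximum is over the $n$ eigenvalues of its transition matrix (counted with algebraic multiplicity) after removing one copy of the eigenvalue $1$. *)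

theory Defs
  imports Complex_Main "Jordan_Normal_Form.Char_Poly"
begin

text \<open>Probability that a single card moves from position \<open>i\<close> to position \<open>j\<close> in one step of the
  overlapping-cycles shuffle; positions are numbered \<open>1, \<dots>, n\<close> from the top of the deck.\<close>

definition card_trans :: "nat \<Rightarrow> nat \<Rightarrow> nat \<Rightarrow> nat \<Rightarrow> real" where
  "card_trans n k i j =
    (if i < n - k then (if j = i + 1 then 1 else 0)
     else if i = n - k then (if j = 1 \<or> j = n - k + 1 then 1/2 else 0)
     else if i < n then (if j = i \<or> j = i + 1 then 1/2 else 0)
     else (if j = 1 \<or> j = n then 1/2 else 0))"

text \<open>Matrix indices start at \<open>0\<close>, so row and column \<open>i\<close> belong to position \<open>i + 1\<close>.\<close>

definition card_matrix :: "nat \<Rightarrow> nat \<Rightarrow> complex mat" where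
  "card_matrix n k = mat n n (\<lambda>(i, j). complex_of_real (card_trans n k (i + 1) (j + 1)))"

text \<open>The multiset \<^term>\<open>proots (char_poly A)\<close> consists of the eigenvalues of \<open>A\<close> with their
  algebraic multiplicities; multiset difference removes a single copy of \<open>1\<close>.\<close>

definition gap :: "nat \<Rightarrow> nat \<Rightarrow> real" where
  "gap n k = 1 - Max (cmod ` set_mset (proots (char_poly (card_matrix n k)) - {#1#}))"

end

theory Submission
  imports "HOL-Analysis.Brouwer_Fixpoint" "HOL-Analysis.Kronecker_Approximation_Theorem" Defs
begin

text \<open>
  Put \<open>m = n - k\<close>. The eigenvalues are the solutions of \<open>(2 z\<^sup>m - 1) (2 z - 1)\<^sup>k = 1\<close>, and \<open>1\<close> is a
  simple one. Since \<open>Ln (2 exp x - 1) = 2 x - x\<^sup>2 + O(x\<^sup>3)\<close>, a root \<open>z = exp x\<close> near the unit circle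
  for which \<open>z\<^sup>m = exp y\<close> with \<open>y = m x + 2 \<pi> \<i> j\<close> small satisfies
  \<open>2 n x = 2 \<pi> \<i> t + k x\<^sup>2 + y\<^sup>2 + \<dots>\<close> with \<open>t = l - 2 j\<close> for some integer \<open>l\<close>. The imaginary part gives
  \<open>Im x \<approx> \<pi> t / n\<close> and \<open>Im y \<approx> \<pi> (l - k t / n)\<close>, and then the real part gives
  \<open>1 - |z| \<approx> \<pi>\<^sup>2 (k t\<^sup>2 + (l n - k t)\<^sup>2) / (2 n\<^sup>3)\<close>. So the gap is governed by the minimum of the form
  \<open>k t\<^sup>2 + (l n - k t)\<^sup>2\<close> over integers \<open>t \<equiv> l (mod 2)\<close> with \<open>t \<noteq> 0\<close>: Dirichlet approximation (and
  Brouwer's theorem to turn an approximate root into a root) bounds it from above, its trivial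
  lower bound \<open>8\<close> gives the cubic bound, and counting the \<open>k\<close> for which it is small gives the bound
  for almost all \<open>k\<close>. Powers of \<open>n\<close> are written through \<open>h = n\<^bsup>-1/4\<^esup>\<close>, so that
  \<open>n\<^bsup>-3/2\<^esup> = h\<^sup>6\<close>.
\<close>

section \<open>The characteristic polynomial\<close>

lemma det_card_matrix:
  fixes x :: complex
  assumes k: "1 \<le> k" "k < n"
  shows "Determinant.det (- char_matrix (card_matrix n k) x)
    = ((2 * x ^ (n - k) - 1) * (2 * x - 1) ^ k - 1) / 2 ^ (k + 1)"
proof -
  define m where "m = n - k"
  have m: "1 \<le> m" "m < n" "m + k = n" using k by (auto simp: m_def)
  define M where "M = - char_matrix (card_matrix n k) x"
  define f :: "nat \<Rightarrow> complex" where
    "f i = (if i < m then x ^ i else (2 * x - 1) ^ (i - m) * (2 * x ^ m - 1))" for i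
  \<comment> \<open>\<open>f\<close> solves all rows of the eigenvector equation except the last one, so putting it into the first
    column leaves a single nonzero entry there, and the complementary minor is triangular.\<close>
  define U where "U = mat n n (\<lambda>(i, j). if j = 0 then f i else if i = j then 1 else 0)"
  define B where "B = M * U"
  have M_carrier [simp]: "M \<in> carrier_mat n n"
    by (simp add: M_def card_matrix_def char_matrix_def)
  have U_carrier [simp]: "U \<in> carrier_mat n n" by (simp add: U_def)
  have B_carrier [simp]: "B \<in> carrier_mat n n" unfolding B_def by (rule mult_carrier_mat[OF M_carrier U_carrier])
  have f0: "f 0 = 1" using m by (simp add: f_def)
  have M_entry: "M $$ (i, j) = (if i = j then x else 0) - complex_of_real (card_trans n k (i + 1) (j + 1))"
    if "i < n" "j < n" for i j
    using that by (simp add: M_def card_matrix_def char_matrix_def)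
  have "Determinant.det U = prod_list (diag_mat U)"
    by (rule det_lower_triangular[of n]) (auto simp: U_def)
  also have "diag_mat U = replicate n 1"
    by (rule nth_equalityI) (auto simp: diag_mat_def U_def f0)
  finally have detU: "Determinant.det U = 1" by simp
  have detB: "Determinant.det B = Determinant.det M"
    unfolding B_def by (subst det_mult[of _ n]) (auto simp: detU)
  have B_sum: "B $$ (i, j) = (\<Sum>l<n. M $$ (i, l) * U $$ (l, j))" if "i < n" "j < n" for i j
    using that carrier_matD[OF M_carrier] carrier_matD[OF U_carrier]
    by (simp add: B_def scalar_prod_def atLeast0LessThan)
  have B_other: "B $$ (i, j) = M $$ (i, j)" if "i < n" "j < n" "j \<noteq> 0" for i j
  proof -
    have "B $$ (i, j) = (\<Sum>l<n. if l = j then M $$ (i, l) else 0)"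
      unfolding B_sum[OF that(1,2)] using that by (intro sum.cong) (auto simp: U_def)
    thus ?thesis using that by simp
  qed
  have B_first: "B $$ (i, 0) = (if i = n - 1 then ((2 * x ^ m - 1) * (2 * x - 1) ^ k - 1) / 2 else 0)"
    if i: "i < n" for i
  proof -
    define T where "T = (\<Sum>l<n. complex_of_real (card_trans n k (i + 1) (l + 1)) * f l)"
    have "B $$ (i, 0) = (\<Sum>l<n. M $$ (i, l) * f l)"
      using i by (subst B_sum) (auto simp: U_def)
    also have "\<dots> = (\<Sum>l<n. (if l = i then x * f l else 0)
        - complex_of_real (card_trans n k (i + 1) (l + 1)) * f l)"
      using i by (intro sum.cong) (auto simp: M_entry algebra_simps)
    also have "\<dots> = x * f i - T"
      using i by (simp add: sum_subtractf T_def)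
    finally have B: "B $$ (i, 0) = x * f i - T" .
    have two: "(\<Sum>l<n. (if l = a \<or> l = b then 1/2 else 0) * f l) = (f a + f b) / 2"
      if "a < n" "b < n" "a \<noteq> b" for a b
    proof -
      have "(\<Sum>l<n. (if l = a \<or> l = b then 1/2 else 0) * f l)
          = (\<Sum>l<n. (if l = a then f l / 2 else 0) + (if l = b then f l / 2 else 0))"
        using that by (intro sum.cong) auto
      also have "\<dots> = (f a + f b) / 2"
        using that by (simp add: sum.distrib add_divide_distrib)
      finally show ?thesis .
    qed
    \<comment> \<open>Row \<open>i\<close> is position \<open>i + 1\<close>. The cases are the
      certain moves, position \<open>n - k\<close>, the lazy positions between it and
      \<open>n\<close>, and position \<open>n\<close>, the only row where the equation can
      fail.\<close>
    consider "i + 1 < m" | "i + 1 = m" | "m \<le> i" "i < n - 1" | "i = n - 1" "m \<le> i"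
      using i m by linarith
    thus ?thesis
    proof cases
      case 1
      have "T = (\<Sum>l<n. if l = i + 1 then f l else 0)"
        unfolding T_def using 1 m by (intro sum.cong) (auto simp: card_trans_def m_def)
      hence "T = f (i + 1)" using 1 m by simp
      thus ?thesis using 1 m by (simp add: B f_def)
    next
      case 2
      have "T = (\<Sum>l<n. (if l = 0 \<or> l = m then 1/2 else 0) * f l)"
        unfolding T_def using 2 m by (intro sum.cong) (auto simp: card_trans_def m_def)
      hence "T = (f 0 + f m) / 2" using 2 m by (subst (asm) two) auto
      thus ?thesis using 2 m by (auto simp: B f_def field_simps simp flip: power_Suc)
    next
      case 3
      have "T = (\<Sum>l<n. (if l = i \<or> l = i + 1 then 1/2 else 0) * f l)"
        unfolding T_def using 3 m by (intro sum.cong) (auto simp: card_trans_def m_def)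
      hence T: "T = (f i + f (i + 1)) / 2" using 3 m by (subst (asm) two) auto
      have "f (i + 1) = (2 * x - 1) * f i" using 3 by (simp add: f_def Suc_diff_le)
      thus ?thesis using 3 by (simp add: B T field_simps)
    next
      case 4
      have "T = (\<Sum>l<n. (if l = 0 \<or> l = i then 1/2 else 0) * f l)"
        unfolding T_def using 4 m by (intro sum.cong) (auto simp: card_trans_def m_def)
      hence T: "T = (f 0 + f i) / 2" using 4 m by (subst (asm) two) auto
      have "k = Suc (i - m)" using 4 m by simp
      hence E: "(2 * x ^ m - 1) * (2 * x - 1) ^ k = (2 * x - 1) * f i"
        using 4 m by (simp add: f_def)
      have "B $$ (i, 0) = ((2 * x - 1) * f i - 1) / 2"
        by (simp add: B T f0 field_simps)
      thus ?thesis using 4 unfolding E by simp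
    qed
  qed
  have "Determinant.det B = (\<Sum>i<n. B $$ (i, 0) * cofactor B i 0)"
    using m by (intro laplace_expansion_column) auto
  also have "\<dots> = (\<Sum>i<n. if i = n - 1 then B $$ (n - 1, 0) * cofactor B (n - 1) 0 else 0)"
    by (intro sum.cong) (auto simp: B_first)
  also have "\<dots> = B $$ (n - 1, 0) * cofactor B (n - 1) 0"
    using m by simp
  also have "cofactor B (n - 1) 0 = (- 1) ^ (n - 1) * Determinant.det (mat_delete B (n - 1) 0)"
    by (simp add: cofactor_def)
  also have "Determinant.det (mat_delete B (n - 1) 0) = (\<Prod>i<n - 1. if i + 1 < m then - 1 else - 1 / 2)"
  proof -
    define C where "C = mat_delete B (n - 1) 0"
    have C [simp]: "C \<in> carrier_mat (n - 1) (n - 1)"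
      unfolding C_def by (rule mat_delete_carrier) simp
    have C_entry: "C $$ (i, j) = M $$ (i, j + 1)" if "i < n - 1" "j < n - 1" for i j
      using that carrier_matD[OF B_carrier] by (auto simp: C_def mat_delete_def B_other)
    \<comment> \<open>\<open>C\<close> is triangular because no card moves down by more than one
      position; its diagonal holds the entries of \<open>M\<close> for the moves from a position to
      the next one.\<close>
    have "Determinant.det C = prod_list (diag_mat C)"
      by (rule det_lower_triangular[of "n - 1"])
        (use C m in \<open>auto simp: C_entry M_entry card_trans_def m_def simp del: One_nat_def\<close>)
    also have "\<dots> = (\<Prod>i<n - 1. C $$ (i, i))"
      using C by (simp add: prod_list_diag_prod atLeast0LessThan)
    also have "\<dots> = (\<Prod>i<n - 1. if i + 1 < m then - 1 else - 1 / 2)"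
      using m by (intro prod.cong) (auto simp: C_entry M_entry card_trans_def m_def)
    finally show ?thesis by (simp add: C_def)
  qed
  \<comment> \<open>The \<open>n - 1\<close> signs cancel against the sign of the cofactor, and
    exactly \<open>k\<close> of the diagonal entries carry a factor \<open>1 / 2\<close>.\<close>
  also have "(\<Prod>i<n - 1. if i + 1 < m then - 1 else - 1 / 2 :: complex)
      = (\<Prod>i<n - 1. (- 1) * (if i + 1 < m then 1 else 1 / 2))"
    by (intro prod.cong) auto
  also have "\<dots> = (- 1) ^ (n - 1) * (\<Prod>i<n - 1. if i < m - 1 then 1 else 1 / 2)"
    unfolding prod.distrib by (simp add: less_diff_conv)
  also have "(\<Prod>i<n - 1. if i < m - 1 then 1 else 1 / 2 :: complex) = (\<Prod>i\<in>{m - 1..<n - 1}. 1 / 2)"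
    by (rule prod.mono_neutral_cong_right) auto
  also have "\<dots> = (1 / 2) ^ k"
  proof -
    have "n - m = k" using m by simp
    thus ?thesis using m by simp
  qed
  finally have "Determinant.det B = B $$ (n - 1, 0) * (1 / 2) ^ k"
    by (simp add: power_mult_distrib[symmetric])
  hence "Determinant.det M = ((2 * x ^ m - 1) * (2 * x - 1) ^ k - 1) / 2 * (1 / 2) ^ k"
    using m by (simp add: detB B_first)
  thus ?thesis by (simp add: M_def m_def power_one_over)
qed

lemma char_poly_card_matrix:
  assumes "1 \<le> k" "k < n"
  shows "char_poly (card_matrix n k)
    = Polynomial.smult (1 / 2 ^ (k + 1)) ((monom 2 (n - k) - 1) * [:-1, 2:] ^ k - 1)"
proof (rule poly_ext)
  fix x :: complex
  have "card_matrix n k \<in> carrier_mat n n" by (simp add: card_matrix_def)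
  thus "poly (char_poly (card_matrix n k)) x
      = poly (Polynomial.smult (1 / 2 ^ (k + 1)) ((monom 2 (n - k) - 1) * [:-1, 2:] ^ k - 1)) x"
    using assms by (simp add: char_poly_matrix det_card_matrix poly_monom) (simp add: field_simps)?
qed

text \<open>The derivative of the polynomial at 1 is \<open>2 * n\<close>, so 1 is a simple root and
  disappears from the set when one copy is removed.\<close>

lemma eigenvalues_card_matrix_diff_1:
  assumes k: "1 \<le> k" "k < n"
  shows "set_mset (proots (char_poly (card_matrix n k)) - {#1#})
    = {z. (2 * z ^ (n - k) - 1) * (2 * z - 1) ^ k = 1 \<and> z \<noteq> 1}"
proof -
  define q :: "complex poly" where "q = (monom 2 (n - k) - 1) * [:-1, 2:] ^ k - 1"
  have q_root: "poly q z = 0 \<longleftrightarrow> (2 * z ^ (n - k) - 1) * (2 * z - 1) ^ k = 1" for z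
    by (simp add: q_def poly_monom algebra_simps)
  have pd: "poly (pderiv q) 1 = 2 * of_nat n"
    using k by (simp add: q_def pderiv_diff pderiv_mult pderiv_power pderiv_monom poly_monom
       pderiv_pCons of_nat_diff)
  hence q0: "q \<noteq> 0" using k by auto
  have "order 1 q = 1"
  proof -
    have "order 1 q \<noteq> 0" using q0 q_root[of 1] by (simp add: order_root)
    moreover have "order 1 q < 2"
    proof (rule ccontr)
      assume "\<not> order 1 q < 2"
      hence "[:-1, 1:] ^ 2 dvd q" using q0 by (simp add: order_divides)
      then obtain r where "q = [:-1, 1:] ^ 2 * r" by (elim dvdE)
      hence "poly (pderiv q) 1 = 0" by (simp add: power2_eq_square pderiv_mult del: mult_pCons_left mult_pCons_right)
      thus False using pd k by simp
    qed
    ultimately show ?thesis by simp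
  qed
  hence "count (proots q) 1 = 1" using q0 by simp
  hence "set_mset (proots q - {#1#}) = set_mset (proots q) - {1}"
    by (auto simp: in_diff_count simp flip: count_greater_zero_iff split: if_splits)
  thus ?thesis
    using q0 q_root by (auto simp: char_poly_card_matrix[OF k] simp flip: q_def)
qed

lemma gap_le_root:
  fixes z :: complex
  assumes k: "1 \<le> k" "k < n"
    and root: "(2 * z ^ (n - k) - 1) * (2 * z - 1) ^ k = 1" and z: "z \<noteq> 1"
  shows "gap n k \<le> 1 - norm z"
proof -
  have "norm z \<le> Max (norm ` set_mset (proots (char_poly (card_matrix n k)) - {#1#}))"
  proof (rule Max_ge)
    show "norm z \<in> norm ` set_mset (proots (char_poly (card_matrix n k)) - {#1#})"
      using assms by (simp add: eigenvalues_card_matrix_diff_1[OF k])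
  qed simp
  thus ?thesis by (simp add: gap_def)
qed

text \<open>The hypothesis \<open>ex\<close> guarantees that \<open>Max\<close> is taken over a
  nonempty finite set and is therefore one of its elements.\<close>

lemma gap_attained:
  assumes k: "1 \<le> k" "k < n"
    and ex: "\<exists>z::complex. (2 * z ^ (n - k) - 1) * (2 * z - 1) ^ k = 1 \<and> z \<noteq> 1"
  obtains z :: complex where "(2 * z ^ (n - k) - 1) * (2 * z - 1) ^ k = 1" "z \<noteq> 1" "gap n k = 1 - norm z"
proof -
  let ?E = "set_mset (proots (char_poly (card_matrix n k)) - {#1#})"
  have E: "?E = {z. (2 * z ^ (n - k) - 1) * (2 * z - 1) ^ k = 1 \<and> z \<noteq> 1}"
    by (rule eigenvalues_card_matrix_diff_1[OF k])
  have "?E \<noteq> {}" using ex unfolding E by blast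
  hence "Max (norm ` ?E) \<in> norm ` ?E" by (intro Max_in) simp_all
  then obtain z where z: "z \<in> ?E" "norm z = Max (norm ` ?E)" by auto
  have "gap n k = 1 - norm z" by (simp only: gap_def z(2))
  moreover from z(1) have "(2 * z ^ (n - k) - 1) * (2 * z - 1) ^ k = 1" "z \<noteq> 1" unfolding E by auto
  ultimately show ?thesis by (intro that)
qed

section \<open>The function \<open>Ln (2 exp x - 1)\<close>\<close>

text \<open>A logarithm of the factor \<open>2 * z - 1\<close> in the coordinate
  \<open>z = exp x\<close>; it makes the product equation for the eigenvalues additive modulo
  \<open>2 * pi * \<i>\<close>.\<close>

definition Ln_2exp :: "complex \<Rightarrow> complex" where
  "Ln_2exp x = Ln (2 * exp x - 1)"

lemma norm_exp_minus_1_le: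
  fixes x :: complex
  assumes "norm x \<le> 1 / 10"
  shows "norm (exp x - 1) \<le> 1 / 9"
proof -
  have "norm (exp x - (\<Sum>i\<le>0. x ^ i / fact i)) \<le> exp \<bar>Re x\<bar> * norm x ^ Suc 0 / fact 0"
    by (rule Taylor_exp)
  hence 1: "norm (exp x - 1) \<le> exp \<bar>Re x\<bar> * norm x" by simp
  have "\<bar>Re x\<bar> \<le> 1 / 10" using abs_Re_le_cmod[of x] assms by linarith
  hence "exp \<bar>Re x\<bar> \<le> 1 / (1 - 1/10)" 
    using exp_minus_ge[of "1/10"] by (smt (verit) exp_le_cancel_iff exp_minus inverse_eq_divide le_divide_eq_1 mult_imp_le_div_pos exp_gt_zero le_imp_inverse_le)
  thus ?thesis using 1 assms 
    using mult_mono[of "exp \<bar>Re x\<bar>" "10/9" "norm x" "1/10"] by simp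
qed

text \<open>Keeps the argument of \<open>Ln\<close> off the branch cut and away from 0, so that
  \<open>Ln_2exp\<close> is holomorphic with bounded derivatives on the disc.\<close>

lemma two_exp_minus_1_near_0:
  fixes x :: complex
  assumes "norm x \<le> 1 / 10"
  shows "Re (2 * exp x - 1) \<ge> 7 / 9" "norm (2 * exp x - 1) \<ge> 7 / 9" "2 * exp x - 1 \<notin> \<real>\<^sub>\<le>\<^sub>0"
    "exp (Ln_2exp x) = 2 * exp x - 1"
proof -
  have "Re (1 - exp x) \<le> 1 / 9" 
    using complex_Re_le_cmod[of "1 - exp x"] norm_exp_minus_1_le[OF assms] by (simp add: norm_minus_commute)
  thus 1: "Re (2 * exp x - 1) \<ge> 7 / 9" by simp
  thus "norm (2 * exp x - 1) \<ge> 7 / 9" using complex_Re_le_cmod order_trans by blast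
  show "2 * exp x - 1 \<notin> \<real>\<^sub>\<le>\<^sub>0" using 1 by (auto simp: complex_nonpos_Reals_iff)
  have "2 * exp x - 1 \<noteq> 0" using 1 by (metis zero_complex.simps(1) not_numeral_le_zero zero_less_divide_iff zero_less_numeral linorder_not_le)
  thus "exp (Ln_2exp x) = 2 * exp x - 1" by (simp add: Ln_2exp_def)
qed

lemma Ln_2exp_derivs:
  fixes x :: complex
  assumes "norm x \<le> 1 / 10"
  defines "u \<equiv> \<lambda>x. 2 * exp x - 1"
  shows "(Ln_2exp has_field_derivative 1 + 1 / u x) (at x within S)"
    "((\<lambda>x. 1 + 1 / u x) has_field_derivative - (2 * exp x) / u x ^ 2) (at x within S)"
    "((\<lambda>x. - (2 * exp x) / u x ^ 2) has_field_derivative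
        8 * exp x ^ 2 / u x ^ 3 - 2 * exp x / u x ^ 2) (at x within S)"
proof -
  have u0: "2 * exp x - 1 \<noteq> 0"
    using two_exp_minus_1_near_0(4)[OF assms(1)] by (metis exp_not_eq_zero)
  have "((\<lambda>x. Ln (2 * exp x - 1)) has_field_derivative (2 * exp x) * inverse (2 * exp x - 1)) (at x within S)"
    using two_exp_minus_1_near_0(3)[OF assms(1)] by (auto intro!: derivative_eq_intros simp: field_simps)
  moreover have "(2 * exp x) * inverse (2 * exp x - 1) = 1 + 1 / u x" using u0 by (simp add: u_def field_simps)
  ultimately show "(Ln_2exp has_field_derivative 1 + 1 / u x) (at x within S)"
    by (simp add: Ln_2exp_def [abs_def])
  show "((\<lambda>x. 1 + 1 / u x) has_field_derivative - (2 * exp x) / u x ^ 2) (at x within S)"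
    unfolding u_def by (rule derivative_eq_intros refl u0)+ (simp add: power2_eq_square)
  show "((\<lambda>x. - (2 * exp x) / u x ^ 2) has_field_derivative
        8 * exp x ^ 2 / u x ^ 3 - 2 * exp x / u x ^ 2) (at x within S)"
    unfolding u_def
  proof (rule derivative_eq_intros refl | simp add: u0)+
    \<comment> \<open>This is the equation left over by the differentiation rules, with
      \<open>exp x\<close> and \<open>2 * exp x - 1\<close> generalised to \<open>e\<close> and
      \<open>v\<close>.\<close>
    have "(- (0 * e + e * 1 * 2) * v\<^sup>2 - - (2 * e) * (complex_of_nat 2 * ((0 * e + e * 1 * 2 - 0) * v ^ (2 - Suc 0))))
        / (v\<^sup>2 * v\<^sup>2) = 8 * e\<^sup>2 / v ^ 3 - 2 * e / v\<^sup>2" if "v \<noteq> 0" for v e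
      using that by (simp add: field_simps eval_nat_numeral)
    from this[OF u0] show "(- (0 * exp x + exp x * 1 * 2) * (2 * exp x - 1)\<^sup>2 - - (2 * exp x) *
          (complex_of_nat 2 * ((0 * exp x + exp x * 1 * 2 - 0) * (2 * exp x - 1) ^ (2 - Suc 0))))
        / ((2 * exp x - 1)\<^sup>2 * (2 * exp x - 1)\<^sup>2)
        = 8 * (exp x)\<^sup>2 / (2 * exp x - 1) ^ 3 - 2 * exp x / (2 * exp x - 1)\<^sup>2" .
  qed (use u0 in simp)
qed

text \<open>Taylor's theorem at 0, with the third derivative bounded by 26 on the disc. The
  remainder in \<open>complex_Taylor\<close> is divided by \<open>fact 2\<close>, hence the constant
  13.\<close>

lemma Ln_2exp_Taylor:
  fixes x :: complex
  assumes "norm x \<le> 1 / 10"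
  shows "norm (Ln_2exp x - (2 * x - x\<^sup>2)) \<le> 13 * norm x ^ 3"
proof -
  define u where "u = (\<lambda>x::complex. 2 * exp x - 1)"
  define d3 where "d3 = (\<lambda>x. 8 * exp x ^ 2 / u x ^ 3 - 2 * exp x / u x ^ 2)"
  define f where "f = (\<lambda>i::nat. if i = 0 then Ln_2exp else if i = 1 then (\<lambda>x. 1 + 1 / u x)
     else if i = 2 then (\<lambda>x. - (2 * exp x) / u x ^ 2) else d3)"
  have "norm (f 0 x - (\<Sum>i\<le>2. f i 0 * (x - 0) ^ i / fact i)) \<le> 26 * norm (x - 0) ^ Suc 2 / fact 2"
  proof (rule complex_Taylor[where S = "cball 0 (1 / 10)"])
    fix i :: nat and y :: complex
    assume "y \<in> cball 0 (1 / 10)" and i: "i \<le> 2"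
    hence y: "norm y \<le> 1 / 10" by simp
    have "i = 0 \<or> i = 1 \<or> i = 2" using i by auto
    thus "(f i has_field_derivative f (Suc i) y) (at y within cball 0 (1 / 10))"
      using Ln_2exp_derivs[OF y, of "cball 0 (1 / 10)"] by (auto simp: f_def u_def d3_def)
  next
    fix y :: complex
    assume "y \<in> cball 0 (1 / 10)"
    hence y: "norm y \<le> 1 / 10" by simp
    have e: "norm (exp y) \<le> 10 / 9"
      using norm_exp_minus_1_le[OF y] norm_triangle_ineq[of "exp y - 1" 1] by simp
    have v: "norm (u y) \<ge> 7 / 9" using two_exp_minus_1_near_0(2)[OF y] by (simp add: u_def)
    have "norm (d3 y) \<le> norm (8 * exp y ^ 2 / u y ^ 3) + norm (2 * exp y / u y ^ 2)"
      unfolding d3_def by (rule norm_triangle_ineq4)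
    also have "\<dots> = 8 * norm (exp y) ^ 2 / norm (u y) ^ 3 + 2 * norm (exp y) / norm (u y) ^ 2"
      by (simp add: norm_divide norm_mult norm_power)
    also have "\<dots> \<le> 8 * (10/9) ^ 2 / (7/9) ^ 3 + 2 * (10/9) / (7/9) ^ 2"
      using e v by (intro add_mono frac_le mult_left_mono power_mono mult_nonneg_nonneg) auto
    also have "\<dots> \<le> 26" by (simp add: power2_eq_square power3_eq_cube)
    finally show "norm (f (Suc 2) y) \<le> 26" by (simp add: f_def)
  qed (use assms in auto)
  thus ?thesis
    by (simp add: f_def u_def Ln_2exp_def numeral_2_eq_2 power3_eq_cube algebra_simps)
qed

lemma Ln_2exp_continuous: "continuous_on (cball 0 (1 / 10)) Ln_2exp"
  using Ln_2exp_derivs(1) by (intro DERIV_continuous_on) auto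

section \<open>Lower bound for the modulus of \<open>2 * exp y - 1\<close>\<close>

text \<open>Jordan's inequality: sine is concave on \<open>[0, pi/2]\<close> and so lies above its
  chord.\<close>

lemma abs_sin_ge_2_div_pi:
  fixes c :: real
  assumes "\<bar>c\<bar> \<le> pi / 2"
  shows "\<bar>sin c\<bar> \<ge> 2 / pi * \<bar>c\<bar>"
proof -
  have "concave_on {0..pi / 2} sin"
    by (rule f''_le0_imp_concave[where f' = cos and f'' = "\<lambda>x. - sin x"])
      (auto intro!: derivative_eq_intros sin_ge_zero)
  from concave_onD[OF this, of "2 / pi * \<bar>c\<bar>" 0 "pi / 2"] have "sin \<bar>c\<bar> \<ge> 2 / pi * \<bar>c\<bar>"
    using assms by (simp add: field_simps)
  thus ?thesis by (cases "c \<ge> 0") auto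
qed

text \<open>With \<open>r = exp (Re y)\<close> the left side equals
  \<open>(2 r - 1)^2 + 4 r (1 - cos (Im y))\<close>. The first term is bounded by
  \<open>exp a \<ge> 1 + a\<close>, the second by Jordan's inequality at \<open>Im y / 2\<close>.
  Unlike the Taylor expansion, this covers all arguments up to \<open>pi\<close>.\<close>

lemma norm_sqr_2exp_minus_1_ge:
  fixes y :: complex
  assumes "Re y \<le> 0" "- Re y \<le> 1 / 10" "\<bar>Im y\<bar> \<le> pi"
  shows "norm (2 * exp y - 1) ^ 2 \<ge> 1 + 4 * Re y + (Im y)\<^sup>2 / 4"
proof -
  define a b where "a = Re y" and "b = Im y"
  define r where "r = exp a"
  have "2 * exp y - 1 = Complex (2 * r * cos b - 1) (2 * r * sin b)"
    by (simp add: complex_eq_iff Re_exp Im_exp r_def a_def b_def)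
  hence "norm (2 * exp y - 1) ^ 2 = (2 * r * cos b - 1)\<^sup>2 + (2 * r * sin b)\<^sup>2"
    by (simp add: cmod_power2)
  also have "\<dots> = 4 * r\<^sup>2 * ((sin b)\<^sup>2 + (cos b)\<^sup>2) - 4 * r * cos b + 1"
  proof -
    have "(2 * r * u - 1)\<^sup>2 + (2 * r * v)\<^sup>2 = 4 * r\<^sup>2 * (v\<^sup>2 + u\<^sup>2) - 4 * r * u + 1" for u v :: real
      by (simp add: power2_eq_square algebra_simps)
    thus ?thesis .
  qed
  also have "\<dots> = (2 * r - 1)\<^sup>2 + 4 * r * (1 - cos b)"
    unfolding sin_cos_squared_add by (simp add: power2_eq_square algebra_simps)
  finally have N: "norm (2 * exp y - 1) ^ 2 = (2 * r - 1)\<^sup>2 + 4 * r * (1 - cos b)" .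
  have r: "r \<ge> 1 + a" "r \<ge> 9/10"
    using exp_ge_add_one_self[of a] assms(2) unfolding r_def a_def by linarith+
  have "(2 * r - 1)\<^sup>2 \<ge> (1 + 2 * a)\<^sup>2" using r assms by (intro power_mono) (auto simp: a_def)
  moreover have "(1 + 2 * a)\<^sup>2 \<ge> 1 + 4 * a" by (simp add: power2_eq_square algebra_simps)
  moreover have "4 * r * (1 - cos b) \<ge> b\<^sup>2 / 4"
  proof -
    have "\<bar>sin (b / 2)\<bar> \<ge> \<bar>b\<bar> / pi"
      using abs_sin_ge_2_div_pi[of "b / 2"] assms by (simp add: b_def)
    moreover have "\<bar>b\<bar> / pi \<ge> \<bar>b\<bar> / 4"
      using pi_less_4 by (intro divide_left_mono) auto
    ultimately have "\<bar>sin (b / 2)\<bar> \<ge> \<bar>b\<bar> / 4" by linarith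
    hence "\<bar>sin (b / 2)\<bar> ^ 2 \<ge> (\<bar>b\<bar> / 4) ^ 2" by (rule power_mono) auto
    hence s: "(sin (b / 2))\<^sup>2 \<ge> b\<^sup>2 / 16" by (simp add: power_divide)
    have C: "1 - cos b = 2 * (sin (b / 2))\<^sup>2" using cos_double_sin[of "b / 2"] by simp
    have "4 * r * (1 - cos b) = 8 * r * (sin (b / 2))\<^sup>2" unfolding C by simp
    moreover have "8 * r * (sin (b / 2))\<^sup>2 \<ge> 4 * (b\<^sup>2 / 16)"
      using s r by (intro mult_mono) auto
    ultimately show ?thesis by linarith
  qed
  ultimately show ?thesis unfolding N by (simp add: a_def b_def)
qed

section \<open>Roots near the unit circle\<close>

text \<open>For \<open>norm z \<ge> 1\<close> both factors have modulus at least 1, so the modulus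
  of \<open>2 * z - 1\<close> is 1 at most. This puts \<open>z\<close> in the disc with diameter
  \<open>[0, 1]\<close>, which meets \<open>norm z \<ge> 1\<close> only at 1.\<close>

lemma root_norm_less_1:
  fixes z :: complex
  assumes root: "(2 * z ^ m - 1) * (2 * z - 1) ^ k = 1" and z: "z \<noteq> 1"
    and k: "k > 0"
  shows "norm z < 1"
proof (rule ccontr)
  assume "\<not> norm z < 1"
  hence r: "norm z \<ge> 1" by simp
  have ge: "norm (2 * v - 1) \<ge> 1" if "norm v \<ge> 1" for v :: complex
    using norm_triangle_ineq2[of "2 * v" 1] that by (simp add: norm_mult)
  have "norm (2 * z ^ m - 1) * norm (2 * z - 1) ^ k = 1"
    using arg_cong[OF root, of norm] by (simp add: norm_mult norm_power)
  moreover have "norm (2 * z ^ m - 1) \<ge> 1"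
    using r by (intro ge) (simp add: norm_power one_le_power)
  moreover have "norm (2 * z - 1) ^ k \<ge> norm (2 * z - 1)"
    using power_increasing[of 1 k "norm (2 * z - 1)"] k ge[OF r] by simp
  ultimately have "norm (2 * z - 1) \<le> 1"
    using mult_right_mono[of 1 "norm (2 * z ^ m - 1)" "norm (2 * z - 1) ^ k"] by simp
  hence "norm (2 * z - 1) ^ 2 \<le> 1 ^ 2" by (intro power_mono) auto
  hence "(2 * Re z - 1)\<^sup>2 + (2 * Im z)\<^sup>2 \<le> 1" by (simp add: cmod_power2)
  hence 1: "(Re z)\<^sup>2 + (Im z)\<^sup>2 \<le> Re z" by (simp add: power2_eq_square algebra_simps)
  have "1 \<le> norm z ^ 2" using r by (simp add: one_le_power)
  hence 2: "(Re z)\<^sup>2 + (Im z)\<^sup>2 \<ge> 1" by (simp add: cmod_power2)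
  have "(Re z - 1)\<^sup>2 + (Im z)\<^sup>2 = (Re z)\<^sup>2 + (Im z)\<^sup>2 - 2 * Re z + 1"
    by (simp add: power2_eq_square algebra_simps)
  also have "\<dots> \<le> 0" using 1 2 by linarith
  finally have "(Re z - 1)\<^sup>2 + (Im z)\<^sup>2 \<le> 0" .
  hence "Re z = 1 \<and> Im z = 0" by (simp add: sum_power2_le_zero_iff)
  thus False using z by (simp add: complex_eq_iff)
qed

text \<open>Expanding gives \<open>a + b \<le> p + q + a q + b p\<close> up to terms of favourable
  sign, and \<open>a q + b p\<close> is at most half of \<open>a + b\<close>.\<close>

lemma product_near_1_bound:
  fixes a b p q :: real
  assumes "a \<ge> 0" "b \<ge> 0" "0 \<le> p" "p \<le> 1/2" "0 \<le> q" "q \<le> 1/2"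
    and "(1 - p + a) * (1 - q + b) \<le> 1"
  shows "a + b \<le> 2 * (p + q)"
proof -
  have "a * q \<le> a * (1/2)" "b * p \<le> b * (1/2)" "a * b \<ge> 0" "p * q \<ge> 0"
    using assms mult_left_mono[of q "1/2" a] mult_left_mono[of p "1/2" b] by auto
  thus ?thesis using assms(7) by (simp add: algebra_simps)
qed

text \<open>A root close to the unit circle has small angles. Taking squared moduli of the equation,
  each factor is bounded below by \<open>norm_sqr_2exp_minus_1_ge\<close> and the
  \<open>k\<close>-th power by Bernoulli's inequality; \<open>product_near_1_bound\<close> then
  applies. The constant 32 is crude, but it brings \<open>x\<close> and \<open>y\<close> into the
  range of the Taylor expansion.\<close>

lemma root_angles_bound:
  fixes x y :: complex
  assumes eq: "(2 * exp y - 1) * (2 * exp x - 1) ^ k = 1"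
    and x: "Re x \<le> 0" "\<bar>Im x\<bar> \<le> pi" and y: "Re y \<le> 0" "\<bar>Im y\<bar> \<le> pi"
    and k: "k > 0"
    and small: "real k * (- Re x) \<le> 1/10" "- Re y \<le> 1/10"
  shows "real k * (Im x)\<^sup>2 + (Im y)\<^sup>2 \<le> 32 * (real k * (- Re x) - Re y)"
proof -
  have "- Re x \<le> real k * (- Re x)"
    using x k mult_right_mono[of 1 "real k" "- Re x"] by simp
  hence s: "- Re x \<le> 1/10" using small by linarith
  define B where "B = norm (2 * exp x - 1) ^ 2"
  define A where "A = norm (2 * exp y - 1) ^ 2"
  have "norm (2 * exp y - 1) * norm (2 * exp x - 1) ^ k = 1"
    using arg_cong[OF eq, of norm] by (simp add: norm_mult norm_power)
  hence "(norm (2 * exp y - 1) * norm (2 * exp x - 1) ^ k) ^ 2 = 1" by simp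
  hence AB: "A * B ^ k = 1"
    by (simp add: A_def B_def power_mult_distrib power_mult[symmetric] mult.commute)
  have A: "A \<ge> 1 - (4 * (- Re y)) + (Im y)\<^sup>2 / 4"
    using norm_sqr_2exp_minus_1_ge[OF y(1) small(2) y(2)] by (simp add: A_def)
  have B: "B \<ge> 1 + (4 * Re x + (Im x)\<^sup>2 / 4)"
    using norm_sqr_2exp_minus_1_ge[OF x(1) s x(2)] by (simp add: B_def)
  have pos: "- 1 \<le> 4 * Re x + (Im x)\<^sup>2 / 4" "0 \<le> 1 + (4 * Re x + (Im x)\<^sup>2 / 4)"
    using s zero_le_power2[of "Im x"] by linarith+
  have "1 + real k * (4 * Re x + (Im x)\<^sup>2 / 4) \<le> (1 + (4 * Re x + (Im x)\<^sup>2 / 4)) ^ k"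
    using Bernoulli_inequality[OF pos(1)] by simp
  also have "\<dots> \<le> B ^ k" using B pos(2) by (intro power_mono) auto
  finally have Bk: "B ^ k \<ge> 1 - 4 * (real k * (- Re x)) + real k * (Im x)\<^sup>2 / 4"
    by (simp add: algebra_simps)
  have "(1 - 4 * (real k * (- Re x)) + real k * (Im x)\<^sup>2 / 4) * (1 - (4 * (- Re y)) + (Im y)\<^sup>2 / 4)
      \<le> B ^ k * A"
  proof (rule mult_mono)
    show "0 \<le> 1 - 4 * - Re y + (Im y)\<^sup>2 / 4" using small zero_le_power2[of "Im y"] by linarith
  qed (use A Bk in \<open>auto simp: B_def\<close>)
  also have "\<dots> = 1" using AB by (simp add: mult.commute)
  finally have "real k * (Im x)\<^sup>2 / 4 + (Im y)\<^sup>2 / 4 \<le> 2 * (4 * (real k * (- Re x)) + 4 * (- Re y))"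
    using small x(1) y(1) by (intro product_near_1_bound) (simp_all add: mult_nonneg_nonpos)
  thus ?thesis by simp
qed

text \<open>The logarithm of the equation is \<open>2 * pi * \<i> * l\<close> for some integer
  \<open>l\<close>. In its linear part \<open>2 k x + 2 y = 2 (m + k) x + 4 pi \<i> j\<close> the
  branch correction \<open>j\<close> is doubled, which is where the parity condition on
  \<open>t = l - 2 j\<close> comes from.\<close>

lemma root_expansion:
  fixes x y :: complex and j :: int
  assumes eq: "(2 * exp y - 1) * (2 * exp x - 1) ^ k = 1"
    and y: "y = of_nat m * x + 2 * of_real pi * \<i> * of_int j"
    and small: "norm x \<le> 1/10" "norm y \<le> 1/10"
  obtains l :: int and R :: complex
  where "norm R \<le> 13 * (real k * norm x ^ 3 + norm y ^ 3)"
    and "2 * of_nat (m + k) * x = 2 * of_real pi * \<i> * of_int (l - 2 * j) + of_nat k * x\<^sup>2 + y\<^sup>2 - R"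
proof -
  define R where "R = of_nat k * (Ln_2exp x - (2 * x - x\<^sup>2)) + (Ln_2exp y - (2 * y - y\<^sup>2))"
  have "exp (of_nat k * Ln_2exp x + Ln_2exp y) = 1"
    using eq unfolding exp_add exp_of_nat_mult two_exp_minus_1_near_0(4)[OF small(1)]
      two_exp_minus_1_near_0(4)[OF small(2)] by (simp add: mult.commute)
  then obtain l :: int where l: "of_nat k * Ln_2exp x + Ln_2exp y = 2 * of_real pi * \<i> * of_int l"
    unfolding exp_eq_1 by (auto simp: complex_eq_iff)
  have "norm R \<le> norm (of_nat k * (Ln_2exp x - (2 * x - x\<^sup>2))) + norm (Ln_2exp y - (2 * y - y\<^sup>2))"
    unfolding R_def by (rule norm_triangle_ineq)
  also have "\<dots> \<le> real k * (13 * norm x ^ 3) + 13 * norm y ^ 3"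
    using Ln_2exp_Taylor[OF small(1)] Ln_2exp_Taylor[OF small(2)]
    by (auto simp: norm_mult intro!: add_mono mult_left_mono)
  finally have "norm R \<le> 13 * (real k * norm x ^ 3 + norm y ^ 3)" by (simp add: algebra_simps)
  moreover have "2 * of_nat (m + k) * x
      = 2 * of_real pi * \<i> * of_int (l - 2 * j) + of_nat k * x\<^sup>2 + y\<^sup>2 - R"
  proof -
    have "R = 2 * of_real pi * \<i> * of_int l - (of_nat k * (2 * x - x\<^sup>2) + (2 * y - y\<^sup>2))"
      unfolding R_def l[symmetric] by (simp add: algebra_simps)
    thus ?thesis by (simp add: y algebra_simps)
  qed
  ultimately show ?thesis by (rule that)
qed

text \<open>Everything is measured in powers of \<open>e\<close>: \<open>sqrt k * x\<close> and
  \<open>y\<close> are \<open>O(e)\<close> and the remainder is \<open>O(e^3)\<close>. The real part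
  of the expansion bounds \<open>k (Im x)^2 + (Im y)^2\<close> by \<open>2 e^2 + O(e^3)\<close>, and
  the imaginary part puts the two angles within \<open>O(e^3)\<close> of those of the lattice point
  \<open>(t, l)\<close>.\<close>

lemma root_lattice_point_log:
  fixes x y :: complex and j :: int and n m k :: nat and p e :: real
  assumes eq: "(2 * exp y - 1) * (2 * exp x - 1) ^ k = 1"
    and y: "y = of_nat m * x + 2 * of_real pi * \<i> * of_int j"
    and n: "m + k = n" and k: "k > 0" and x0: "x \<noteq> 0"
    and range: "Re x < 0" "\<bar>Im x\<bar> \<le> pi" "\<bar>Im y\<bar> \<le> pi"
    and e: "e \<ge> 0" "e \<le> 3/2000" "real n * (- Re x) = e\<^sup>2"
  obtains t l :: int where "t \<noteq> 0" "even (t - l)"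
    and "pi\<^sup>2 * (real k * (of_int t)\<^sup>2 + (of_int l * real n - real k * of_int t)\<^sup>2)
      \<le> 2 * real n ^ 3 * (- Re x) * (1 + 5500 * e)"
proof -
  define s \<theta> \<phi> where "s = - Re x" and "\<theta> = Im x" and "\<phi> = Im y"
  \<comment> \<open>The quadratic form weights the angle of \<open>x\<close> by \<open>k\<close>;
    scaling \<open>x\<close> by \<open>rk\<close> puts it on the same footing as
    \<open>y\<close>.\<close>
  define rk where "rk = sqrt (real k)"
  have rk: "rk\<^sup>2 = real k" "rk \<ge> 1" using k by (auto simp: rk_def)
  have s0: "s > 0" using range by (simp add: s_def)
  have ns: "real n * s = e\<^sup>2" using e by (simp add: s_def)
  have nkm: "real n = real m + real k" using n by simp
  have ks: "real k * s \<le> e\<^sup>2" unfolding ns[symmetric] using s0 nkm by (intro mult_right_mono) auto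
  have ms: "real m * s \<le> e\<^sup>2" unfolding ns[symmetric] using s0 nkm by (intro mult_right_mono) auto
  have ee: "e\<^sup>2 \<le> e * (3/2000)" using mult_left_mono[OF e(2) e(1)] by (simp add: power2_eq_square)
  have Re_y: "Re y = - (real m * s)" by (simp add: y s_def)
  have Im_y: "\<phi> = real m * \<theta> + 2 * pi * of_int j" by (simp add: y \<phi>_def \<theta>_def)
  have n1: "real n \<ge> 1" using k n by simp
  have rkk: "rk \<le> real k" using rk by (metis power2_eq_square mult_le_cancel_left1 order_trans zero_le_one zero_less_one linorder_not_le mult_mono')
  have rks: "rk * s \<le> e\<^sup>2" using rkk s0 ks mult_right_mono[OF rkk, of s] by linarith
  have E2: "real k * \<theta>\<^sup>2 + \<phi>\<^sup>2 \<le> 32 * e\<^sup>2"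
  proof -
    have "real k * (Im x)\<^sup>2 + (Im y)\<^sup>2 \<le> 32 * (real k * (- Re x) - Re y)"
      by (rule root_angles_bound[OF eq]) 
        (use range k ks ms ee e Re_y s0 in \<open>auto simp flip: s_def\<close>)
    also have "real k * (- Re x) - Re y = e\<^sup>2"
      using ns nkm Re_y by (simp add: s_def[symmetric] algebra_simps)
    finally show ?thesis by (simp add: \<theta>_def \<phi>_def)
  qed
  have th: "rk * \<bar>\<theta>\<bar> \<le> 6 * e"
  proof (rule power2_le_imp_le)
    show "(rk * \<bar>\<theta>\<bar>)\<^sup>2 \<le> (6 * e)\<^sup>2" using E2 by (simp add: power_mult_distrib rk) (smt (verit) zero_le_power2)
  qed (use e in simp)
  have ph: "\<bar>\<phi>\<bar> \<le> 6 * e"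
  proof (rule power2_le_imp_le)
    have "real k * \<theta>\<^sup>2 \<ge> 0" by simp
    hence "\<phi>\<^sup>2 \<le> 36 * e\<^sup>2" using E2 zero_le_power2[of e] by linarith
    thus "\<bar>\<phi>\<bar>\<^sup>2 \<le> (6 * e)\<^sup>2" by (simp add: power_mult_distrib)
  qed (use e in simp)
  have nx: "norm x \<le> s + \<bar>\<theta>\<bar>" using cmod_le[of x] s0 by (simp add: s_def \<theta>_def)
  have ny: "norm y \<le> real m * s + \<bar>\<phi>\<bar>" using cmod_le[of y] s0 by (simp add: Re_y \<phi>_def)
  have X: "rk * norm x \<le> 7 * e"
  proof -
    have "rk * norm x \<le> rk * s + rk * \<bar>\<theta>\<bar>" using mult_left_mono[OF nx, of rk] rk by (simp add: algebra_simps)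
    thus ?thesis using rks th ee e by linarith
  qed
  have Y: "norm y \<le> 7 * e" using ny ph ms ee e by linarith
  have x7: "norm x \<le> 7 * e" using X mult_right_mono[OF rk(2), of "norm x"] by simp
  obtain l :: int and R :: complex where R: "norm R \<le> 13 * (real k * norm x ^ 3 + norm y ^ 3)"
    and exp: "2 * of_nat (m + k) * x
      = 2 * of_real pi * \<i> * of_int (l - 2 * j) + of_nat k * x\<^sup>2 + y\<^sup>2 - R"
    by (rule root_expansion[OF eq y]) (use x7 Y e in auto)
  have "real k * norm x ^ 3 = (rk * norm x)\<^sup>2 * norm x"
    by (simp add: power_mult_distrib rk(1) power3_eq_cube power2_eq_square[of "norm x"])
  also have "\<dots> \<le> (7 * e)\<^sup>2 * (7 * e)"
    by (rule mult_mono[OF power_mono[OF X] x7]) (use rk e in auto)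
  finally have "real k * norm x ^ 3 \<le> 343 * e ^ 3" by (simp add: power2_eq_square power3_eq_cube)
  moreover have "norm y ^ 3 \<le> (7 * e) ^ 3" using Y by (intro power_mono) auto
  \<comment> \<open>The constant is \<open>13 * (343 + 343)\<close>.\<close>
  ultimately have R9: "norm R \<le> 8918 * e ^ 3" using R by (simp add: power_mult_distrib)
  define t where "t = l - 2 * j"
  \<comment> \<open>The real part of the expansion improves the crude factor 32 to
    \<open>2 + O(e)\<close>.\<close>
  have "2 * (real m + real k) * Re x
      = real k * ((Re x)\<^sup>2 - (Im x)\<^sup>2) + ((Re y)\<^sup>2 - (Im y)\<^sup>2) - Re R"
    using arg_cong[OF exp, of Re] by (simp add: power2_eq_square)
  hence "- (2 * (real n * s)) = real k * (s\<^sup>2 - \<theta>\<^sup>2) + ((real m * s)\<^sup>2 - \<phi>\<^sup>2) - Re R"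
    by (simp add: Re_y nkm s_def \<theta>_def \<phi>_def algebra_simps)
  from this[unfolded ns] have Re_eq: "real k * \<theta>\<^sup>2 + \<phi>\<^sup>2 = 2 * e\<^sup>2 + real k * s\<^sup>2 + (real m * s)\<^sup>2 - Re R"
    by (simp add: algebra_simps)
  \<comment> \<open>The deviation of \<open>Im x\<close> from the resonant angle
    \<open>pi * t / n\<close>, scaled by \<open>n\<close>; the imaginary part of the expansion shows
    that it is \<open>O(e^3)\<close>.\<close>
  define d where "d = real n * \<theta> - pi * of_int t"
  have Im_eq: "d = - (real k * s * \<theta>) - real m * s * \<phi> - Im R / 2"
    using arg_cong[OF exp, of Im] nkm
    by (simp add: t_def[symmetric] power2_eq_square Re_y d_def) (simp add: s_def algebra_simps \<theta>_def \<phi>_def)?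
  have e3: "e ^ 3 \<ge> 0" using e by simp
  have "e\<^sup>2 * e\<^sup>2 = e ^ 3 * e" by (simp add: power2_eq_square power3_eq_cube)
  hence e4: "e\<^sup>2 * e\<^sup>2 \<le> e ^ 3 * (3/2000)" using mult_left_mono[OF e(2) e3] by simp
  have "real k * s\<^sup>2 = (rk * s) * (rk * s)" by (simp add: power2_eq_square flip: rk(1))
  also have "\<dots> \<le> e\<^sup>2 * e\<^sup>2" using rks rk s0 by (intro mult_mono) auto
  finally have ks2: "real k * s\<^sup>2 \<le> e ^ 3 * (3/2000)" using e4 by linarith
  have "(real m * s)\<^sup>2 \<le> e\<^sup>2 * e\<^sup>2" unfolding power2_eq_square[of "real m * s"]
    using ms s0 by (intro mult_mono) auto
  hence ms2: "(real m * s)\<^sup>2 \<le> e ^ 3 * (3/2000)" using e4 by linarith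
  have E2': "real k * \<theta>\<^sup>2 + \<phi>\<^sup>2 \<le> 2 * e\<^sup>2 + 8919 * e ^ 3"
    using Re_eq ks2 ms2 R9 abs_Re_le_cmod[of R] e3 by linarith
  have d: "\<bar>d\<bar> \<le> 5000 * e ^ 3"
  proof -
    have "real k * s * \<bar>\<theta>\<bar> = (rk * s) * (rk * \<bar>\<theta>\<bar>)" by (simp add: power2_eq_square flip: rk(1))
    also have "\<dots> \<le> e\<^sup>2 * (6 * e)"
      by (rule mult_mono[OF rks th]) (use rk in auto)
    finally have 1: "\<bar>real k * s * \<theta>\<bar> \<le> 6 * e ^ 3" 
      using s0 by (simp add: abs_mult power2_eq_square power3_eq_cube)
    have "real m * s * \<bar>\<phi>\<bar> \<le> e\<^sup>2 * (6 * e)"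
      by (rule mult_mono[OF ms ph]) auto
    hence 2: "\<bar>real m * s * \<phi>\<bar> \<le> 6 * e ^ 3" 
      using s0 by (simp add: abs_mult power2_eq_square power3_eq_cube)
    show ?thesis using Im_eq 1 2 R9 abs_Im_le_cmod[of R] e3 by linarith
  qed
  \<comment> \<open>For \<open>t = 0\<close> the number \<open>v = n * norm x\<close> is small,
    which forces \<open>j = 0\<close> and \<open>y = m x\<close>. The expansion then has no constant
    term and reads \<open>2 v \<le> 2 v^2 + 26 v^3\<close>, impossible for
    \<open>0 < v \<le> 1/10\<close>.\<close>
  have t0: "t \<noteq> 0"
  proof
    assume t: "t = 0"
    define v where "v = real n * norm x"
    have v0: "v > 0" using x0 n1 by (simp add: v_def)
    have "v \<le> real n * s + real n * \<bar>\<theta>\<bar>" using mult_left_mono[OF nx, of "real n"] by (simp add: v_def algebra_simps)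
    also have "real n * \<bar>\<theta>\<bar> = \<bar>d\<bar>" by (simp add: d_def t abs_mult)
    finally have "v \<le> e\<^sup>2 + 5000 * e ^ 3" using ns d by linarith
    moreover have "e ^ 3 \<le> e\<^sup>2 * (3/2000)"
      using mult_left_mono[OF e(2), of "e\<^sup>2"] by (simp add: power2_eq_square power3_eq_cube)
    moreover have "e * (3/2000) \<le> (3/2000) * (3/2000)" using e by (intro mult_right_mono) auto
    ultimately have v: "v \<le> 1/10" using ee e by linarith
    have mx: "norm (of_nat m * x) \<le> v" using nkm by (simp add: norm_mult v_def mult_right_mono)
    have "norm (2 * of_real pi * \<i> * of_int j) \<le> norm y + norm (of_nat m * x)"
      using norm_triangle_ineq4[of y "of_nat m * x"] by (simp add: y)
    hence "2 * pi * \<bar>of_int j\<bar> \<le> 1" using Y mx v e by (simp add: norm_mult)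
    have "j = 0"
    proof (rule ccontr)
      assume "j \<noteq> 0"
      hence "2 * pi * 1 \<le> 2 * pi * \<bar>of_int j\<bar>" by (intro mult_left_mono) auto
      thus False using \<open>2 * pi * \<bar>of_int j\<bar> \<le> 1\<close> pi_ge_two by linarith
    qed
    hence yx: "y = of_nat m * x" by (simp add: y)
    hence yv: "norm y \<le> v" using mx by simp
    have xv: "norm x \<le> v" using n1 by (simp add: v_def mult_le_cancel_right1)
    have kx: "real k * norm x \<le> v" using nkm by (simp add: v_def mult_right_mono)
    have "2 * of_nat n * x = of_nat k * x\<^sup>2 + y\<^sup>2 - R" using exp t n by (simp add: t_def)
    hence "norm (2 * of_nat n * x) \<le> norm (of_nat k * x\<^sup>2) + norm (y\<^sup>2) + norm R"
      by (metis norm_triangle_ineq norm_triangle_ineq4 add_right_mono order_trans)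
    hence "2 * v \<le> (real k * norm x) * norm x + norm y * norm y + norm R"
      by (simp add: norm_mult norm_power v_def power2_eq_square)
    moreover have "norm R \<le> 13 * (real k * norm x * norm x * norm x + norm y * norm y * norm y)"
      using R by (simp add: power3_eq_cube mult.assoc)
    moreover have "(real k * norm x) * norm x \<le> v * v" "norm y * norm y \<le> v * v"
      "real k * norm x * norm x * norm x \<le> v * v * v" "norm y * norm y * norm y \<le> v * v * v"
      using v0 by (auto intro!: mult_mono kx xv yv)
    moreover have "2 * v \<le> 2 * w + 26 * u"
      if "2 * v \<le> a + b + c" "c \<le> 13 * (a' + b')" "a \<le> w" "b \<le> w" "a' \<le> u" "b' \<le> u"
      for a b c a' b' u w :: real
      using that by (simp add: algebra_simps)
    ultimately have "2 * v \<le> 2 * (v * v) + 26 * (v * v * v)" by blast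
    hence "2 * v \<le> v * (2 * v + 26 * (v * v))" by (simp add: algebra_simps)
    moreover have "v * v \<le> 1/10 * (1/10)" by (rule mult_mono[OF v v]) (use v0 in auto)
    hence "2 * v + 26 * (v * v) < 2" using v by simp
    hence "v * (2 * v + 26 * (v * v)) < v * 2" using v0 by (rule mult_strict_left_mono)
    ultimately show False by simp
  qed
  \<comment> \<open>\<open>P\<close> and \<open>Q\<close> are the values of
    \<open>rk * \<theta>\<close> and \<open>\<phi>\<close> at the exact resonant angle. They differ
    from these by at most \<open>\<bar>d\<bar>\<close>, so the squares change only by
    \<open>O(e^4)\<close>.\<close>
  define P where "P = pi * rk * of_int t / real n"
  define Q where "Q = pi * (of_int l * real n - real k * of_int t) / real n"
  have P_eq: "P = rk * \<theta> - rk / real n * d"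
    using n1 by (simp add: P_def d_def field_simps)
  have Q_eq: "Q = \<phi> - real m / real n * d"
    using n1 nkm by (simp add: Q_def d_def Im_y t_def field_simps)
  have ab: "(a - c * d)\<^sup>2 \<le> a\<^sup>2 + 2 * ((6 * e) * (5000 * e ^ 3)) + (5000 * e ^ 3) * (5000 * e ^ 3)"
    if a: "\<bar>a\<bar> \<le> 6 * e" and c: "0 \<le> c" "c \<le> 1" for a c :: real
  proof -
    have cd: "\<bar>c * d\<bar> \<le> 5000 * e ^ 3"
      using mult_mono[of c 1 "\<bar>d\<bar>" "5000 * e ^ 3"] c d by (simp add: abs_mult)
    have "(a - c * d)\<^sup>2 = a\<^sup>2 - 2 * (a * (c * d)) + (c * d) * (c * d)"
      by (simp add: power2_eq_square algebra_simps)
    moreover have "(c * d) * (c * d) \<le> (5000 * e ^ 3) * (5000 * e ^ 3)"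
      using mult_mono[OF cd cd] e3 by (simp flip: abs_mult)
    moreover have "\<bar>a * (c * d)\<bar> \<le> (6 * e) * (5000 * e ^ 3)"
      unfolding abs_mult[of a] by (rule mult_mono[OF a cd]) (use e in auto)
    ultimately show ?thesis by linarith
  qed
  have "P\<^sup>2 + Q\<^sup>2 \<le> real k * \<theta>\<^sup>2 + \<phi>\<^sup>2 + 4 * ((6 * e) * (5000 * e ^ 3)) + 2 * ((5000 * e ^ 3) * (5000 * e ^ 3))"
  proof -
    have "rk \<le> real n" using rkk nkm by simp
    hence "P\<^sup>2 \<le> (rk * \<theta>)\<^sup>2 + 2 * ((6 * e) * (5000 * e ^ 3)) + (5000 * e ^ 3) * (5000 * e ^ 3)"
      unfolding P_eq using th rk n1 by (intro ab) (auto simp: abs_mult)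
    moreover have "Q\<^sup>2 \<le> \<phi>\<^sup>2 + 2 * ((6 * e) * (5000 * e ^ 3)) + (5000 * e ^ 3) * (5000 * e ^ 3)"
      unfolding Q_eq using ph nkm n1 by (intro ab) auto
    ultimately show ?thesis by (simp add: power_mult_distrib rk)
  qed
  also have "\<dots> \<le> 2 * e\<^sup>2 * (1 + 5500 * e)"
  proof -
    have "e * e ^ 3 \<le> (3/2000) * e ^ 3" using e e3 by (intro mult_right_mono) auto
    moreover have "e ^ 3 * e ^ 3 \<le> (1/100000000) * e ^ 3"
    proof (rule mult_right_mono)
      have "e ^ 3 \<le> (3/2000) ^ 3" using e by (intro power_mono) auto
      thus "e ^ 3 \<le> 1/100000000" by (simp add: power3_eq_cube)
    qed (use e3 in simp)
    moreover have "2 * e\<^sup>2 * (1 + 5500 * e) = 2 * e\<^sup>2 + 11000 * e ^ 3"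
      by (simp add: power2_eq_square power3_eq_cube algebra_simps)
    moreover have "4 * ((6 * e) * (5000 * e ^ 3)) = 120000 * (e * e ^ 3)"
      "2 * ((5000 * e ^ 3) * (5000 * e ^ 3)) = 50000000 * (e ^ 3 * e ^ 3)" by simp_all
    ultimately show ?thesis using E2' e3 by linarith
  qed
  finally have PQ: "P\<^sup>2 + Q\<^sup>2 \<le> 2 * (real n * s) * (1 + 5500 * e)" by (simp add: ns)
  have "real n * P = pi * rk * of_int t" "real n * Q = pi * (of_int l * real n - real k * of_int t)"
    using n1 by (simp_all add: P_def Q_def)
  hence "(real n * P)\<^sup>2 + (real n * Q)\<^sup>2
      = (pi * rk * of_int t)\<^sup>2 + (pi * (of_int l * real n - real k * of_int t))\<^sup>2" by simp
  hence "pi\<^sup>2 * (real k * (of_int t)\<^sup>2 + (of_int l * real n - real k * of_int t)\<^sup>2) = (real n)\<^sup>2 * (P\<^sup>2 + Q\<^sup>2)"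
    by (simp only: power_mult_distrib rk(1) distrib_left mult.assoc)
  also have "\<dots> \<le> (real n)\<^sup>2 * (2 * (real n * s) * (1 + 5500 * e))"
    using PQ by (intro mult_left_mono) auto
  also have "\<dots> = 2 * real n ^ 3 * (- Re x) * (1 + 5500 * e)"
    by (simp add: s_def power2_eq_square power3_eq_cube)
  finally show ?thesis using t0 by (intro that[of t l]) (auto simp: t_def)
qed

text \<open>Passes from \<open>z\<close> to principal logarithms of \<open>z\<close> and
  \<open>z ^ m\<close>, whose imaginary parts are at most \<open>pi\<close> in modulus;
  \<open>j\<close> is the branch mismatch. Replacing \<open>- ln (norm z)\<close> by
  \<open>1 - norm z\<close> costs a factor \<open>1 + 2 h\<close>.\<close>

lemma root_lattice_point:
  fixes z :: complex and n k :: nat and h :: real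
  assumes root: "(2 * z ^ (n - k) - 1) * (2 * z - 1) ^ k = 1" and z: "z \<noteq> 1"
    and k: "1 \<le> k" "k < n"
    and h: "0 < h" "h \<le> 1/1000" "real n * h ^ 4 = 1"
    and g: "1 - norm z \<le> h ^ 6"
  obtains t l :: int where "t \<noteq> 0" "even (t - l)"
    and "pi\<^sup>2 * (real k * (of_int t)\<^sup>2 + (of_int l * real n - real k * of_int t)\<^sup>2)
      \<le> 2 * real n ^ 3 * (1 - norm z) * (1 + 9000 * h)"
proof -
  define m where "m = n - k"
  define r where "r = norm z"
  have r1: "r < 1" using root_norm_less_1[OF root z] k by (simp add: r_def)
  have h6: "h ^ 6 \<le> h" "h ^ 6 \<le> 1/2"
    using power_decreasing[of 1 6 h] h by auto
  have r2: "r \<ge> 1/2" using g h6 by (simp add: r_def)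
  have z0: "z \<noteq> 0" using r2 by (auto simp: r_def)
  define x where "x = Ln z"
  define y where "y = Ln (z ^ m)"
  have ex: "exp x = z" and ey: "exp y = z ^ m" using z0 by (auto simp: x_def y_def)
  have "exp y = exp (of_nat m * x)" by (simp add: ex ey exp_of_nat_mult)
  then obtain j :: int where "y = of_nat m * x + (of_int (2 * j) * pi) * \<i>"
    unfolding exp_eq by blast
  hence y: "y = of_nat m * x + 2 * of_real pi * \<i> * of_int j" by (simp add: algebra_simps)
  have Re_x: "Re x = ln r" using z0 by (simp add: x_def r_def)
  define s where "s = - ln r"
  have s0: "s > 0" using r1 r2 by (simp add: s_def)
  have "ln (1 / r) \<le> 1 / r - 1" using r2 by (intro ln_le_minus_one) auto
  hence "s \<le> (1 - r) / r" using r2 by (simp add: s_def ln_div field_simps)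
  also have "\<dots> \<le> (1 - r) * (1 + 2 * (1 - r))"
  proof -
    have "(1 - r) * 1 \<le> (1 - r) * ((1 + 2 * (1 - r)) * r)"
    proof (rule mult_left_mono)
      have "(1 - r) * (2 * r - 1) \<ge> 0" using r1 r2 by (intro mult_nonneg_nonneg) auto
      thus "1 \<le> (1 + 2 * (1 - r)) * r" by (simp add: algebra_simps)
    qed (use r1 in simp)
    thus ?thesis using r2 by (simp add: divide_le_eq mult.assoc)
  qed
  also have "\<dots> \<le> (1 - r) * (1 + 2 * h)"
    using g h6 r1 by (intro mult_left_mono) (auto simp: r_def)
  finally have s: "s \<le> (1 - r) * (1 + 2 * h)" .
  also have "\<dots> \<le> h ^ 6 * 2" using g h r1 by (intro mult_mono) (auto simp: r_def)
  finally have s2: "s \<le> h ^ 6 * 2" .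
  \<comment> \<open>Since \<open>n * h^6 = h^2\<close>, this \<open>e\<close> is at most
    \<open>3/2 * h\<close>; thus \<open>5500 * e\<close> becomes \<open>8250 * h\<close>, and the
    constant 9000 absorbs the remaining factor \<open>1 + 2 h\<close>.\<close>
  define e where "e = sqrt (real n * s)"
  have e2: "real n * s = e\<^sup>2" using s0 by (simp add: e_def)
  have "real n * s \<le> real n * (h ^ 6 * 2)" using s2 by (intro mult_left_mono) auto
  also have "\<dots> = (real n * h ^ 4) * (2 * h\<^sup>2)" by (simp add: eval_nat_numeral)
  also have "\<dots> \<le> (3/2 * h)\<^sup>2" using h by (simp add: power2_eq_square)
  finally have "e\<^sup>2 \<le> (3/2 * h)\<^sup>2" unfolding e2 .
  hence e: "e \<le> 3/2 * h" by (rule power2_le_imp_le) (use h in simp)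
  have e0: "e \<ge> 0" using s0 by (simp add: e_def)
  have eq: "(2 * exp y - 1) * (2 * exp x - 1) ^ k = 1" using root by (simp add: ex ey m_def)
  obtain t l :: int where tl: "t \<noteq> 0" "even (t - l)"
    and le: "pi\<^sup>2 * (real k * (of_int t)\<^sup>2 + (of_int l * real n - real k * of_int t)\<^sup>2)
      \<le> 2 * real n ^ 3 * (- Re x) * (1 + 5500 * e)"
  proof (rule root_lattice_point_log[OF eq y, where n = n and e = e])
    show "m + k = n" "k > 0" using k by (auto simp: m_def)
    show "x \<noteq> 0" using ex z by auto
    show "\<bar>Im x\<bar> \<le> pi" "\<bar>Im y\<bar> \<le> pi"
      using mpi_less_Im_Ln[of z] Im_Ln_le_pi[of z] mpi_less_Im_Ln[of "z ^ m"] Im_Ln_le_pi[of "z ^ m"] z0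
      by (auto simp: x_def y_def abs_le_iff)
  qed (use s0 e0 e e2 h in \<open>auto simp: Re_x s_def\<close>)
  have "2 * real n ^ 3 * (- Re x) * (1 + 5500 * e) = 2 * real n ^ 3 * (s * (1 + 5500 * e))"
    by (simp add: Re_x s_def)
  also have "s * (1 + 5500 * e) \<le> ((1 - r) * (1 + 2 * h)) * (1 + 8250 * h)"
    using s e e0 s0 h r1 by (intro mult_mono) auto
  also have "\<dots> = (1 - r) * (1 + 8252 * h + 16500 * (h * h))" by (simp add: algebra_simps)
  also have "\<dots> \<le> (1 - r) * (1 + 9000 * h)"
  proof (rule mult_left_mono)
    have "h * h \<le> (1/1000) * h" using h by (intro mult_right_mono) auto
    thus "1 + 8252 * h + 16500 * (h * h) \<le> 1 + 9000 * h" using h by linarith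
  qed (use r1 in simp)
  finally have "2 * real n ^ 3 * (- Re x) * (1 + 5500 * e) \<le> 2 * real n ^ 3 * ((1 - r) * (1 + 9000 * h))"
    by (simp add: mult_left_mono)
  with le have "pi\<^sup>2 * (real k * (of_int t)\<^sup>2 + (of_int l * real n - real k * of_int t)\<^sup>2)
      \<le> 2 * real n ^ 3 * ((1 - r) * (1 + 9000 * h))" by (rule order_trans)
  hence "pi\<^sup>2 * (real k * (of_int t)\<^sup>2 + (of_int l * real n - real k * of_int t)\<^sup>2)
      \<le> 2 * real n ^ 3 * (1 - norm z) * (1 + 9000 * h)" by (simp only: r_def mult.assoc)
  thus ?thesis using tl by (intro that)
qed

section \<open>Existence of an eigenvalue near the unit circle\<close>

text \<open>Dirichlet's theorem gives a resonant angle \<open>\<theta> = pi * t / n\<close> for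
  which \<open>m * \<theta>\<close> is close to \<open>2 * pi * u\<close>. Near
  \<open>\<i> * \<theta>\<close> the logarithm of the equation reads
  \<open>2 n x = 2 pi \<i> t - R x\<close> with \<open>R\<close> of order \<open>h^2\<close>, so
  Brouwer's theorem yields an exact solution.\<close>

lemma exists_root_near_1:
  fixes n k :: nat and h :: real
  assumes k: "1 \<le> k" "k < n" and h: "0 < h" "h \<le> 1/1000" "real n * h ^ 4 = 1"
  obtains z :: complex where "(2 * z ^ (n - k) - 1) * (2 * z - 1) ^ k = 1" "z \<noteq> 1"
    and "1 - norm z \<le> (2 * pi\<^sup>2 + 6000 * h) * h ^ 6"
proof -
  define m where "m = n - k"
  have nkm: "real n = real m + real k" using k by (simp add: m_def)
  have n0: "real n > 0" using k by simp
  define rk where "rk = sqrt (real k)"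
  have rk: "rk\<^sup>2 = real k" "rk \<ge> 1" using k by (auto simp: rk_def)
  have "rk * 1 \<le> rk * rk" using rk by (intro mult_left_mono) auto
  hence rkk: "rk \<le> real n" using nkm rk(1) by (simp add: power2_eq_square)
  have n_eq: "real n = 1 / h ^ 4" using h by (simp add: field_simps)
  have hh: "h * h \<le> h * (1/1000)" using h by (intro mult_left_mono) auto
  have rk_h: "rk * h\<^sup>2 \<le> 1"
  proof (rule power2_le_imp_le)
    have "(rk * h\<^sup>2)\<^sup>2 = real k * h ^ 4" by (simp add: power_mult_distrib rk(1))
    also have "\<dots> \<le> real n * h ^ 4" using k h by (intro mult_right_mono) auto
    finally show "(rk * h\<^sup>2)\<^sup>2 \<le> 1\<^sup>2" using h by simp
  qed simp
  define c where "c = pi * sqrt 2"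
  have sq2: "sqrt 2 \<le> 3/2" by (rule real_le_lsqrt) (auto simp: power2_eq_square)
  have c: "c \<ge> 0" "c \<le> 6" "c\<^sup>2 = 2 * pi\<^sup>2"
    using mult_mono[of pi 4 "sqrt 2" "3/2"] pi_less_4 sq2 by (auto simp: c_def power_mult_distrib)
  \<comment> \<open>\<open>N\<close> balances the two angles: \<open>sqrt k * \<theta>\<close> is at
    most about \<open>pi * N * h^2\<close>, and \<open>\<bar>\<phi>\<bar>\<close> at most
    \<open>2 * pi / N\<close>. Both equal \<open>c * h\<close> when
    \<open>N = sqrt 2 / h\<close>.\<close>
  define N where "N = nat \<lceil>sqrt 2 / h\<rceil>"
  have N: "real N \<ge> sqrt 2 / h" "real N \<le> sqrt 2 / h + 1"
    using h by (auto simp: N_def of_nat_nat)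
  have "sqrt 2 / h > 0" using h by simp
  hence N0: "N > 0" using N(1) by (metis of_nat_0_less_iff order_less_le_trans)
  obtain u t :: int where t: "0 < t" "t \<le> int N"
    and tu: "\<bar>of_int t * (real m / (2 * real n)) - of_int u\<bar> < 1 / real N"
    using Dirichlet_approx[OF N0] by blast
  define \<theta> where "\<theta> = pi * of_int t / real n"
  define \<phi> where "\<phi> = real m * \<theta> - 2 * pi * of_int u"
  have th0: "\<theta> \<ge> pi / real n" using t n0 by (simp add: \<theta>_def field_simps)
  have th: "rk * \<theta> \<le> c * h + 4 * h\<^sup>2"
  proof -
    have "real_of_int t \<le> sqrt 2 / h + 1" using t N(2) by linarith
    hence "pi * real_of_int t \<le> pi * (sqrt 2 / h + 1)" by (intro mult_left_mono) auto
    hence "\<theta> \<le> pi * (sqrt 2 / h + 1) / real n" using n0 by (simp add: \<theta>_def divide_right_mono)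
    also have "\<dots> = (c * h + pi * h\<^sup>2) * h\<^sup>2" 
      using h by (simp add: n_eq c_def field_simps eval_nat_numeral)
    finally have "rk * \<theta> \<le> rk * ((c * h + pi * h\<^sup>2) * h\<^sup>2)" using rk by (intro mult_left_mono) auto
    also have "\<dots> = (c * h + pi * h\<^sup>2) * (rk * h\<^sup>2)" by simp
    also have "\<dots> \<le> (c * h + pi * h\<^sup>2) * 1" using c h rk_h by (intro mult_left_mono) auto
    also have "\<dots> \<le> c * h + 4 * h\<^sup>2" using pi_less_4 by (simp add: mult_right_mono)
    finally show ?thesis .
  qed
  have ph: "\<bar>\<phi>\<bar> \<le> c * h"
  proof -
    have "\<phi> = 2 * pi * (of_int t * (real m / (2 * real n)) - of_int u)"
      using n0 by (simp add: \<phi>_def \<theta>_def field_simps)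
    hence "\<bar>\<phi>\<bar> = 2 * pi * \<bar>of_int t * (real m / (2 * real n)) - of_int u\<bar>"
      by (simp add: abs_mult)
    also have "\<dots> \<le> 2 * pi * (1 / real N)" using tu by (intro mult_left_mono) auto
    also have "1 / real N \<le> 1 / (sqrt 2 / h)" using N h N0 by (intro divide_left_mono) auto
    also have "2 * pi * (1 / (sqrt 2 / h)) = c * h" using real_sqrt_mult_self[of 2] h by (simp add: c_def field_simps)
    finally show ?thesis by simp
  qed
  \<comment> \<open>The correction \<open>R x / (2 n)\<close> is at most
    \<open>107 h^2 / (2 n)\<close>, so \<open>G\<close> maps the ball of this radius into
    itself.\<close>
  define \<rho> where "\<rho> = 100 * h\<^sup>2 / real n"
  have \<rho>: "\<rho> > 0" "real n * \<rho> = 100 * h\<^sup>2" using h n0 by (auto simp: \<rho>_def)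
  define x0 where "x0 = \<i> * of_real \<theta>"
  define Y where "Y = (\<lambda>x. of_nat m * x - 2 * of_real pi * \<i> * of_int u)"
  define R where "R = (\<lambda>x. of_nat k * (Ln_2exp x - 2 * x) + (Ln_2exp (Y x) - 2 * Y x))"
  define G where "G = (\<lambda>x. x0 - R x / (2 * of_nat n))"
  have nx: "rk * norm x \<le> c * h + 104 * h\<^sup>2" and ny: "norm (Y x) \<le> c * h + 104 * h\<^sup>2"
    if x: "x \<in> cball x0 \<rho>" for x
  proof -
    have d: "norm (x - x0) \<le> \<rho>" using x by (simp add: dist_norm norm_minus_commute)
    have "norm x \<le> norm x0 + norm (x - x0)" using norm_triangle_sub[of x x0] by simp
    moreover have "0 \<le> \<theta>" by (rule order_trans[OF _ th0]) simp
    hence "norm x0 = \<theta>" by (simp add: x0_def norm_mult)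
    ultimately have "norm x \<le> \<theta> + \<rho>" using d by linarith
    hence "rk * norm x \<le> rk * (\<theta> + \<rho>)" using rk by (intro mult_left_mono) auto
    moreover have "rk * \<rho> \<le> 100 * h\<^sup>2" using mult_right_mono[OF rkk, of \<rho>] \<rho> by simp
    ultimately show "rk * norm x \<le> c * h + 104 * h\<^sup>2" using th by (simp add: algebra_simps)
    have "Y x = \<i> * of_real \<phi> + of_nat m * (x - x0)" 
      by (simp add: Y_def x0_def \<phi>_def algebra_simps)
    hence "norm (Y x) \<le> \<bar>\<phi>\<bar> + real m * norm (x - x0)"
      using norm_triangle_ineq[of "\<i> * of_real \<phi>" "of_nat m * (x - x0)"] by (simp add: norm_mult)
    also have "real m * norm (x - x0) \<le> real n * \<rho>" using d nkm by (intro mult_mono) auto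
    finally show "norm (Y x) \<le> c * h + 104 * h\<^sup>2" using ph \<rho> zero_le_power2[of h] by linarith
  qed
  have ch: "c * h + 104 * h\<^sup>2 \<le> 7 * h"
    using mult_right_mono[OF c(2), of h] h(1) hh unfolding power2_eq_square by linarith
  have nx7: "rk * norm x \<le> 7 * h" "norm (Y x) \<le> 7 * h" "norm x \<le> 7 * h"
    "norm x \<le> 1/10" "norm (Y x) \<le> 1/10" if x: "x \<in> cball x0 \<rho>" for x
  proof -
    show 1: "rk * norm x \<le> 7 * h" "norm (Y x) \<le> 7 * h" using nx[OF x] ny[OF x] ch by auto
    show 2: "norm x \<le> 7 * h" using mult_right_mono[OF rk(2), of "norm x"] 1 by simp
    show "norm x \<le> 1/10" "norm (Y x) \<le> 1/10" using 1 2 h by auto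
  qed
  \<comment> \<open>\<open>R'\<close> is the cubic remainder left after the quadratic terms of
    \<open>R\<close> are taken out; it is needed for the sharp constant in the real part.\<close>
  define R' where "R' = (\<lambda>x. R x + (of_nat k * x\<^sup>2 + (Y x)\<^sup>2))"
  have R': "norm (R' x) \<le> 8918 * h ^ 3" if x: "x \<in> cball x0 \<rho>" for x
  proof -
    have "R' x = of_nat k * (Ln_2exp x - (2 * x - x\<^sup>2)) + (Ln_2exp (Y x) - (2 * Y x - (Y x)\<^sup>2))"
      by (simp add: R'_def R_def algebra_simps)
    also have "norm \<dots> \<le> norm (of_nat k * (Ln_2exp x - (2 * x - x\<^sup>2)))
        + norm (Ln_2exp (Y x) - (2 * Y x - (Y x)\<^sup>2))" by (rule norm_triangle_ineq)
    also have "\<dots> \<le> real k * (13 * norm x ^ 3) + 13 * norm (Y x) ^ 3"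
      using Ln_2exp_Taylor[of x] Ln_2exp_Taylor[of "Y x"] nx7[OF x]
      by (auto simp: norm_mult intro!: add_mono mult_left_mono)
    also have "real k * (13 * norm x ^ 3) = 13 * ((rk * norm x)\<^sup>2 * norm x)"
      by (simp add: power_mult_distrib rk(1) power3_eq_cube power2_eq_square[of "norm x"])
    also have "(rk * norm x)\<^sup>2 * norm x \<le> (7 * h)\<^sup>2 * (7 * h)"
      by (rule mult_mono[OF power_mono[OF nx7(1)[OF x]] nx7(3)[OF x]]) (use rk h in auto)
    also have "norm (Y x) ^ 3 \<le> (7 * h) ^ 3" by (rule power_mono[OF nx7(2)[OF x]]) auto
    finally show ?thesis by (simp add: power2_eq_square power3_eq_cube)
  qed
  have R: "norm (R x) \<le> 107 * h\<^sup>2" if x: "x \<in> cball x0 \<rho>" for x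
  proof -
    have "norm (R x) \<le> norm (R' x) + norm (of_nat k * x\<^sup>2 + (Y x)\<^sup>2)"
      using norm_triangle_ineq4[of "R' x" "of_nat k * x\<^sup>2 + (Y x)\<^sup>2"] by (simp add: R'_def)
    also have "norm (of_nat k * x\<^sup>2 + (Y x)\<^sup>2) \<le> (rk * norm x)\<^sup>2 + norm (Y x) ^ 2"
      using norm_triangle_ineq[of "of_nat k * x\<^sup>2" "(Y x)\<^sup>2"]
      by (simp add: norm_mult norm_power power_mult_distrib rk(1))
    also have "(rk * norm x)\<^sup>2 \<le> (7 * h)\<^sup>2" using nx7(1)[OF x] rk by (intro power_mono) auto
    also have "norm (Y x) ^ 2 \<le> (7 * h)\<^sup>2" using nx7(2)[OF x] by (intro power_mono) auto
    also have "norm (R' x) \<le> 8918 * h ^ 3" by (rule R'[OF x])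
    also have "8918 * h ^ 3 \<le> 9 * h\<^sup>2"
      using mult_left_mono[OF h(2), of "h\<^sup>2"] zero_le_power2[of h]
      unfolding power3_eq_cube power2_eq_square by linarith
    finally show ?thesis by (simp add: power_mult_distrib)
  qed
  obtain x where x: "x \<in> cball x0 \<rho>" and fix_x: "G x = x"
  proof (rule brouwer_ball[OF \<rho>(1)])
    show "continuous_on (cball x0 \<rho>) G"
    proof -
      have "continuous_on (cball x0 \<rho>) Ln_2exp"
        by (rule continuous_on_subset[OF Ln_2exp_continuous]) (use nx7(4) in auto)
      moreover have cY: "continuous_on (cball x0 \<rho>) Y"
        unfolding Y_def by (intro continuous_intros)
      moreover have "continuous_on (cball x0 \<rho>) (\<lambda>x. Ln_2exp (Y x))"
        by (rule continuous_on_compose2[OF Ln_2exp_continuous cY]) (use nx7(5) in auto)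
      ultimately show ?thesis
        unfolding G_def R_def using n0 by (intro continuous_intros) auto
    qed
    show "G \<in> cball x0 \<rho> \<rightarrow> cball x0 \<rho>"
    proof (rule Pi_I)
      fix x assume x: "x \<in> cball x0 \<rho>"
      have "dist x0 (G x) = norm (R x) / (2 * real n)"
        by (simp add: G_def dist_norm norm_divide norm_mult)
      also have "\<dots> \<le> 107 * h\<^sup>2 / (2 * real n)" using R[OF x] n0 by (intro divide_right_mono) auto
      also have "\<dots> \<le> \<rho>" using n0 by (simp add: \<rho>_def field_simps)
      finally show "G x \<in> cball x0 \<rho>" by simp
    qed
  qed
  have nfix: "2 * of_nat n * x = 2 * of_real pi * \<i> * of_int t - R x"
  proof -
    have "2 * of_nat n * x = 2 * of_nat n * (x0 - R x / (2 * of_nat n))" using fix_x by (simp add: G_def)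
    also have "\<dots> = 2 * of_nat n * x0 - R x" using n0 by (simp add: field_simps)
    also have "2 * of_nat n * x0 = 2 * of_real pi * \<i> * of_int t"
      using n0 by (simp add: x0_def \<theta>_def)
    finally show ?thesis .
  qed
  \<comment> \<open>The fixed-point equation turns the logarithm of the product into
    \<open>2 * pi * \<i> * (t - 2 * u)\<close>, so the product is 1.\<close>
  have "of_nat k * Ln_2exp x + Ln_2exp (Y x) = R x + 2 * of_nat k * x + 2 * Y x"
    by (simp add: R_def algebra_simps)
  also have "\<dots> = R x + 2 * of_nat n * x - 2 * (2 * of_real pi * \<i> * of_int u)"
    using k by (simp add: Y_def m_def of_nat_diff algebra_simps)
  also have "\<dots> = of_int (2 * (t - 2 * u)) * of_real pi * \<i>" unfolding nfix by (simp add: algebra_simps)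
  finally have "exp (of_nat k * Ln_2exp x + Ln_2exp (Y x)) = 1" unfolding exp_eq_1
    by (auto intro!: exI[of _ "t - 2 * u"])
  hence eq: "(2 * exp x - 1) ^ k * (2 * exp (Y x) - 1) = 1"
    unfolding exp_add exp_of_nat_mult two_exp_minus_1_near_0(4)[OF nx7(4)[OF x]] two_exp_minus_1_near_0(4)[OF nx7(5)[OF x]] .
  have "exp (Y x) = exp (of_nat m * x)" unfolding exp_eq by (intro exI[of _ "- u"]) (simp add: Y_def)
  hence "exp (Y x) = exp x ^ (n - k)" by (simp only: exp_of_nat_mult m_def)
  with eq have root: "(2 * exp x ^ (n - k) - 1) * (2 * exp x - 1) ^ k = 1"
    by (simp only: mult.commute)
  \<comment> \<open>The ball around \<open>\<i> * \<theta>\<close> has radius less than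
    \<open>pi / n\<close>, and \<open>\<theta>\<close> is at least \<open>pi / n\<close>; hence
    \<open>Im x\<close> is positive, while it is far below \<open>2 * pi\<close>.\<close>
  have not1: "exp x \<noteq> 1"
  proof
    assume "exp x = 1"
    then obtain j :: int where j: "Im x = of_int (2 * j) * pi" unfolding exp_eq_1 by auto
    have "\<bar>Im (x - x0)\<bar> \<le> \<rho>" using x abs_Im_le_cmod[of "x - x0"] by (simp add: dist_norm norm_minus_commute)
    hence "Im x \<ge> \<theta> - \<rho>" by (simp add: x0_def)
    moreover have "\<rho> < pi / real n"
    proof -
      have "100 * h\<^sup>2 < 2" using hh h(1,2) unfolding power2_eq_square by linarith
      thus ?thesis using pi_ge_two n0 unfolding \<rho>_def by (intro divide_strict_right_mono) auto
    qed
    ultimately have "Im x > 0" using th0 by linarith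
    hence "j > 0" using j by (simp add: zero_less_mult_iff)
    hence "2 * pi \<le> Im x" unfolding j by simp
    moreover have "Im x \<le> 1/10" using abs_Im_le_cmod[of x] nx7(4)[OF x] by linarith
    ultimately show False using pi_ge_two by linarith
  qed
  \<comment> \<open>The squares of the real parts enter with a favourable sign, so only the two
    angles, each at most about \<open>c * h\<close>, contribute:
    \<open>2 c^2 h^2 = 4 pi^2 h^2\<close>, and dividing by 2 gives the constant
    \<open>2 pi^2\<close>.\<close>
  have "- (2 * real n * Re x) = Re (R x)" using arg_cong[OF nfix, of Re] by simp
  also have "R x = R' x - (of_nat k * x\<^sup>2 + (Y x)\<^sup>2)" by (simp add: R'_def)
  also have "Re \<dots> = Re (R' x) - (real k * ((Re x)\<^sup>2 - (Im x)\<^sup>2) + ((Re (Y x))\<^sup>2 - (Im (Y x))\<^sup>2))"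
    by (simp add: power2_eq_square)
  also have "\<dots> \<le> 8918 * h ^ 3 + (real k * (Im x)\<^sup>2 + (Im (Y x))\<^sup>2)"
  proof -
    have "real k * (Re x)\<^sup>2 \<ge> 0" "(Re (Y x))\<^sup>2 \<ge> 0" by auto
    thus ?thesis using R'[OF x] complex_Re_le_cmod[of "R' x"] unfolding right_diff_distrib by linarith
  qed
  also have "real k * (Im x)\<^sup>2 + (Im (Y x))\<^sup>2 \<le> 2 * (c * h + 104 * h\<^sup>2)\<^sup>2"
  proof -
    have "real k * (Im x)\<^sup>2 = (rk * \<bar>Im x\<bar>)\<^sup>2" by (simp add: power_mult_distrib rk(1))
    also have "\<dots> \<le> (c * h + 104 * h\<^sup>2)\<^sup>2"
      using order_trans[OF mult_left_mono[OF abs_Im_le_cmod[of x], of rk] nx[OF x]] rk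
      by (intro power_mono) auto
    moreover have "\<bar>Im (Y x)\<bar>\<^sup>2 \<le> (c * h + 104 * h\<^sup>2)\<^sup>2"
      using order_trans[OF abs_Im_le_cmod ny[OF x]] by (intro power_mono) auto
    ultimately show ?thesis by simp
  qed
  also have "2 * (c * h + 104 * h\<^sup>2)\<^sup>2 = 4 * pi\<^sup>2 * h\<^sup>2 + 416 * (c * h ^ 3) + 21632 * (h * h ^ 3)"
  proof -
    have "2 * (c * h + 104 * h\<^sup>2)\<^sup>2 = 2 * c\<^sup>2 * h\<^sup>2 + 416 * (c * h ^ 3) + 21632 * (h * h ^ 3)"
      by (simp add: power2_eq_square power3_eq_cube algebra_simps)
    thus ?thesis unfolding c(3) by simp
  qed
  also have "8918 * h ^ 3 + \<dots> \<le> 4 * pi\<^sup>2 * h\<^sup>2 + 12000 * h ^ 3"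
  proof -
    have "h ^ 3 \<ge> 0" using h by simp
    moreover from this have "c * h ^ 3 \<le> 6 * h ^ 3" "h * h ^ 3 \<le> (1/1000) * h ^ 3"
      using c h by (auto intro!: mult_right_mono)
    ultimately show ?thesis by linarith
  qed
  finally have "real n * (- Re x) \<le> 2 * pi\<^sup>2 * h\<^sup>2 + 6000 * h ^ 3" by simp
  hence "(real n * (- Re x)) * h ^ 4 \<le> (2 * pi\<^sup>2 * h\<^sup>2 + 6000 * h ^ 3) * h ^ 4"
    using h by (intro mult_right_mono) auto
  also have "(real n * (- Re x)) * h ^ 4 = - Re x" using h(3) by (simp add: mult.commute mult.left_commute)
  also have "(2 * pi\<^sup>2 * h\<^sup>2 + 6000 * h ^ 3) * h ^ 4 = (2 * pi\<^sup>2 + 6000 * h) * h ^ 6"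
    by (simp add: eval_nat_numeral algebra_simps)
  finally have "1 - norm (exp x) \<le> (2 * pi\<^sup>2 + 6000 * h) * h ^ 6"
    using exp_ge_add_one_self[of "Re x"] unfolding norm_exp_eq_Re by linarith
  thus ?thesis using root not1 by (intro that)
qed

section \<open>Bounds for the resonance form\<close>

lemma card_nat_near_le:
  fixes c w :: real
  assumes "w \<ge> 0"
  shows "finite {k::nat. \<bar>real k - c\<bar> \<le> w}" "real (card {k::nat. \<bar>real k - c\<bar> \<le> w}) \<le> 2 * w + 1"
proof -
  let ?A = "{k::nat. \<bar>real k - c\<bar> \<le> w}"
  have sub: "int ` ?A \<subseteq> {\<lceil>c - w\<rceil>..\<lfloor>c + w\<rfloor>}"
    by (auto simp: ceiling_le_iff le_floor_iff abs_le_iff)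
  have "finite (int ` ?A)" using sub by (rule finite_subset) auto
  thus fin: "finite ?A" by (rule finite_imageD) auto
  have "card ?A = card (int ` ?A)" by (rule card_image[symmetric]) auto
  also have "\<dots> \<le> card {\<lceil>c - w\<rceil>..\<lfloor>c + w\<rfloor>}" using sub by (intro card_mono) auto
  also have "\<dots> = nat (\<lfloor>c + w\<rfloor> - \<lceil>c - w\<rceil> + 1)" by simp
  finally have "real (card ?A) \<le> real (nat (\<lfloor>c + w\<rfloor> - \<lceil>c - w\<rceil> + 1))" by simp
  also have "\<dots> \<le> 2 * w + 1"
  proof (cases "\<lfloor>c + w\<rfloor> - \<lceil>c - w\<rceil> + 1 \<ge> 0")
    case True
    hence "real (nat (\<lfloor>c + w\<rfloor> - \<lceil>c - w\<rceil> + 1)) = of_int \<lfloor>c + w\<rfloor> - of_int \<lceil>c - w\<rceil> + 1" by simp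
    also have "\<dots> \<le> (c + w) - (c - w) + 1"
      using of_int_floor_le[of "c + w"] le_of_int_ceiling[of "c - w"] by linarith
    finally show ?thesis by simp
  qed (use assms in auto)
  finally show "real (card ?A) \<le> 2 * w + 1" .
qed

text \<open>Comparison with the integral of \<open>min 1 (q^2 / t^2)\<close> over the half-line,
  which is \<open>2 q\<close>. The induction carries the integral up to \<open>N\<close>, namely
  \<open>N\<close> before the break at \<open>q\<close> and \<open>2 q - q^2 / N\<close> after
  it.\<close>

lemma sum_min_1_inverse_squares_le:
  fixes q :: real
  assumes q: "q \<ge> 0"
  shows "(\<Sum>t=1..N. min 1 (q\<^sup>2 / (real t)\<^sup>2)) \<le> 2 * q"
proof -
  have "(\<Sum>t=1..N. min 1 (q\<^sup>2 / (real t)\<^sup>2)) \<le> (if real N \<le> q then real N else 2 * q - q\<^sup>2 / real N)"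
  proof (induction N)
    case (Suc N)
    define a where "a = real (Suc N)"
    have a: "real N = a - 1" "a \<ge> 1" by (auto simp: a_def)
    have sum: "(\<Sum>t=1..Suc N. min 1 (q\<^sup>2 / (real t)\<^sup>2)) = (\<Sum>t=1..N. min 1 (q\<^sup>2 / (real t)\<^sup>2)) + min 1 (q\<^sup>2 / a\<^sup>2)"
      by (simp add: a_def)
    consider "a \<le> q" | "a - 1 \<le> q" "q < a" | "q < a - 1" by linarith
    hence "(\<Sum>t=1..N. min 1 (q\<^sup>2 / (real t)\<^sup>2)) + min 1 (q\<^sup>2 / a\<^sup>2) \<le> (if a \<le> q then a else 2 * q - q\<^sup>2 / a)"
    proof cases
      case 1
      thus ?thesis using Suc.IH a by simp
    next
      case 2
      have "(a - 1 + q\<^sup>2 / a\<^sup>2) - (2 * q - q\<^sup>2 / a) = (a - q) * ((a - q) * a - (a + q)) / a\<^sup>2"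
        using a by (simp add: field_simps power2_eq_square)
      also have "\<dots> \<le> 0"
      proof -
        have "(a - q) * a \<le> 1 * a" using 2 a by (intro mult_right_mono) auto
        hence "(a - q) * a - (a + q) \<le> 0" using q by linarith
        thus ?thesis using 2 by (intro divide_nonpos_nonneg mult_nonneg_nonpos) auto
      qed
      finally have "a - 1 + q\<^sup>2 / a\<^sup>2 \<le> 2 * q - q\<^sup>2 / a" by simp
      moreover have "(\<Sum>t=1..N. min 1 (q\<^sup>2 / (real t)\<^sup>2)) \<le> a - 1" using Suc.IH 2(1) unfolding a(1) by simp
      moreover have "min 1 (q\<^sup>2 / a\<^sup>2) \<le> q\<^sup>2 / a\<^sup>2" by simp
      ultimately have "(\<Sum>t=1..N. min 1 (q\<^sup>2 / (real t)\<^sup>2)) + min 1 (q\<^sup>2 / a\<^sup>2) \<le> 2 * q - q\<^sup>2 / a" by linarith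
      moreover have "\<not> a \<le> q" using 2 by simp
      ultimately show ?thesis by (simp only: if_False)
    next
      case 3
      have "q\<^sup>2 / a\<^sup>2 \<le> q\<^sup>2 / (a * (a - 1))"
        using 3 q a by (intro divide_left_mono) (auto simp: power2_eq_square intro!: mult_pos_pos mult_left_mono)
      also have "\<dots> = q\<^sup>2 / (a - 1) - q\<^sup>2 / a"
        using 3 q a by (simp add: field_simps power2_eq_square)
      finally have "q\<^sup>2 / a\<^sup>2 \<le> q\<^sup>2 / (a - 1) - q\<^sup>2 / a" .
      moreover have "(\<Sum>t=1..N. min 1 (q\<^sup>2 / (real t)\<^sup>2)) \<le> 2 * q - q\<^sup>2 / (a - 1)" using Suc.IH 3 unfolding a(1) by simp
      moreover have "min 1 (q\<^sup>2 / a\<^sup>2) \<le> q\<^sup>2 / a\<^sup>2" by simp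
      ultimately have "(\<Sum>t=1..N. min 1 (q\<^sup>2 / (real t)\<^sup>2)) + min 1 (q\<^sup>2 / a\<^sup>2) \<le> 2 * q - q\<^sup>2 / a" by linarith
      moreover have "\<not> a \<le> q" using 3 by simp
      ultimately show ?thesis by (simp only: if_False)
    qed
    thus ?case unfolding sum a_def by simp
  qed (use q in simp)
  also have "\<dots> \<le> 2 * q" using q by auto
  finally show ?thesis .
qed

text \<open>A value of at most \<open>D\<close> requires \<open>k t^2 \<le> D\<close> and
  \<open>\<bar>l n - k t\<bar> \<le> sqrt D\<close>. The pairs with \<open>l = 0\<close> give the
  term \<open>sqrt D / 2\<close>. For \<open>l \<noteq> 0\<close>, \<open>k\<close> lies in a short
  interval around \<open>l n / t\<close>, and the lengths are summed over the few admissible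
  pairs.\<close>

lemma card_near_resonant_le:
  fixes n :: nat and h D :: real
  assumes h: "0 < h" "h \<le> 1/1000" "real n * h ^ 4 = 1"
    and D: "D \<ge> 1" "8 * D * h ^ 6 \<le> 1"
  shows "real (card {k\<in>{1..<n}. \<exists>t l::int. t \<noteq> 0 \<and> even (t - l) \<and>
      real k * (of_int t)\<^sup>2 + (of_int l * real n - real k * of_int t)\<^sup>2 \<le> D})
    \<le> sqrt D / 2 + 9/2 * D * h\<^sup>2"
proof -
  define S where "S = {k\<in>{1..<n}. \<exists>t l::int. t \<noteq> 0 \<and> even (t - l) \<and>
      real k * (of_int t)\<^sup>2 + (of_int l * real n - real k * of_int t)\<^sup>2 \<le> D}"
  define r where "r = sqrt D"
  have r: "r \<ge> 1" "r\<^sup>2 = D" using D by (auto simp: r_def)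
  have n0: "real n > 0" using h(3) by (cases n) auto
  have n_eq: "real n = 1 / h ^ 4" using h by (simp add: field_simps)
  \<comment> \<open>As \<open>n * h = 1 / h^3\<close>, the second hypothesis on \<open>D\<close>
    makes \<open>r\<close> much smaller than \<open>n\<close>.\<close>
  have rh: "r \<le> real n * h"
  proof (rule power2_le_imp_le)
    have "0 \<le> D * h ^ 6" using D h by simp
    hence "r\<^sup>2 * h ^ 6 \<le> 1" using D(2) r(2) by simp
    hence "r\<^sup>2 \<le> 1 / h ^ 6" using h by (simp add: field_simps)
    also have "\<dots> = (real n * h)\<^sup>2" using h by (simp add: n_eq field_simps eval_nat_numeral)
    finally show "r\<^sup>2 \<le> (real n * h)\<^sup>2" .
  qed (use h in simp)
  have rn: "r \<le> real n / 10"
    using mult_left_mono[OF h(2), of "real n"] rh by simp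
  \<comment> \<open>\<open>T\<close> bounds the product \<open>t * l\<close>: for
    \<open>l \<ge> 1\<close> the product \<open>k * t\<close> is at least
    \<open>9/10 * l * n\<close>, and multiplying by \<open>t\<close> stays below
    \<open>D\<close>.\<close>
  define T where "T = D / (9/10 * real n)"
  have T0: "T > 0" using D n0 by (simp add: T_def)
  have T_le: "T \<le> r / 10"
  proof -
    have "D \<le> r * (real n * h)" using r rh by (simp add: power2_eq_square flip: r(2))
    also have "\<dots> \<le> r * (real n * (1/1000))" using r n0 h by (intro mult_left_mono) auto
    finally have "D \<le> r * (real n * (1/1000))" .
    moreover have "0 \<le> r * real n" using r n0 by simp
    ultimately show ?thesis using n0 by (simp add: T_def field_simps)
  qed
  have sqrtT: "sqrt T \<le> 106/100 * r * h\<^sup>2"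
  proof (rule real_le_lsqrt)
    show "0 \<le> 106/100 * r * h\<^sup>2" using r(1) by simp
    have "T = 10/9 * (r\<^sup>2 * h ^ 4)" using h by (simp add: T_def r n_eq)
    also have "\<dots> \<le> (106/100)\<^sup>2 * (r\<^sup>2 * h ^ 4)" by (intro mult_right_mono) (auto simp: power2_eq_square)
    also have "\<dots> = (106/100 * r * h\<^sup>2)\<^sup>2" unfolding power_mult_distrib by simp
    finally show "T \<le> (106/100 * r * h\<^sup>2)\<^sup>2" .
  qed
  define M where "M = nat \<lfloor>T\<rfloor>"
  define Lm where "Lm = (\<lambda>t::nat. min t (nat \<lfloor>T / real t\<rfloor>))"
  define K where "K = (\<lambda>t l::nat. {k::nat. \<bar>real k - real l * real n / real t\<bar> \<le> r / real t})"
  define A where "A = {1..nat \<lfloor>r / 2\<rfloor>}"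
  have sub: "S \<subseteq> A \<union> (\<Union>t\<in>{1..M}. \<Union>l\<in>{1..Lm t}. K t l)"
  proof
    fix k assume "k \<in> S"
    then obtain t' l' :: int where k: "1 \<le> k" "k < n" and tl': "t' \<noteq> 0" "even (t' - l')"
      and le': "real k * (of_int t')\<^sup>2 + (of_int l' * real n - real k * of_int t')\<^sup>2 \<le> D"
      by (auto simp: S_def)
    \<comment> \<open>The form is unchanged under \<open>(t, l)\<close> to \<open>(-t, -l)\<close>,
      so \<open>t\<close> may be taken positive; then \<open>l\<close> cannot be negative.\<close>
    define t where "t = \<bar>t'\<bar>"
    define l where "l = (if t' > 0 then l' else - l')"
    have tl: "t > 0" "even (t - l)" using tl' by (auto simp: t_def l_def)
    have "(of_int l * real n - real k * of_int t)\<^sup>2 = (of_int l' * real n - real k * of_int t')\<^sup>2"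
      using tl' by (auto simp: t_def l_def power2_eq_square algebra_simps)
    moreover have "(real_of_int t)\<^sup>2 = (of_int t')\<^sup>2" by (simp add: t_def)
    ultimately have le: "real k * (of_int t)\<^sup>2 + (of_int l * real n - real k * of_int t)\<^sup>2 \<le> D"
      using le' by simp
    have kt2: "real k * (of_int t)\<^sup>2 \<le> D" using le zero_le_power2[of "of_int l * real n - real k * of_int t"] by linarith
    have "0 \<le> real k * (of_int t)\<^sup>2" by simp
    hence "(of_int l * real n - real k * of_int t)\<^sup>2 \<le> r\<^sup>2" using le r by linarith
    hence "\<bar>of_int l * real n - real k * of_int t\<bar> \<le> \<bar>r\<bar>" by (simp only: abs_le_square_iff)
    hence lin: "\<bar>of_int l * real n - real k * of_int t\<bar> \<le> r"
      using r(1) by simp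
    have kt0: "real k * of_int t \<ge> 0" using tl by simp
    have l0: "l \<ge> 0"
    proof (rule ccontr)
      assume "\<not> l \<ge> 0"
      hence "of_int l * real n \<le> (-1) * real n" by (intro mult_right_mono) auto
      thus False using lin kt0 rn n0 by linarith
    qed
    show "k \<in> A \<union> (\<Union>t\<in>{1..M}. \<Union>l\<in>{1..Lm t}. K t l)"
    proof (cases "l = 0")
      \<comment> \<open>For \<open>l = 0\<close> parity makes \<open>t\<close> even, hence at least
        2; this saves the factor 2 in the size of \<open>A\<close>.\<close>
      case True
      hence "even t" using tl by simp
      hence "t \<ge> 2" using tl by (auto elim!: evenE)
      hence "real k * 2 \<le> real k * of_int t" by (intro mult_left_mono) auto
      hence "real k \<le> r / 2" using lin True by simp
      hence "k \<le> nat \<lfloor>r / 2\<rfloor>" by (simp add: le_nat_floor)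
      thus ?thesis using k by (simp add: A_def)
    next
      case False
      hence l1: "l \<ge> 1" using l0 by simp
      define a where "a = nat t"
      define b where "b = nat l"
      have ab: "t = int a" "l = int b" "a \<ge> 1" "b \<ge> 1" using tl l1 by (auto simp: a_def b_def)
      have lin: "\<bar>real b * real n - real k * real a\<bar> \<le> r" using lin by (simp add: ab)
      have kt2: "real k * real a * real a \<le> D" using kt2 by (simp add: ab power2_eq_square mult.assoc)
      have "1 * real n \<le> real b * real n" using ab by (intro mult_right_mono) auto
      hence "9/10 * (real b * real n) \<le> real k * real a" using lin rn by linarith
      hence "9/10 * (real b * real n) * real a \<le> real k * real a * real a" by (intro mult_right_mono) auto
      hence "9/10 * (real b * real n) * real a \<le> D" using kt2 by linarith
      hence abT: "real a * real b \<le> T" using n0 by (simp add: T_def field_simps)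
      have "real a * 1 \<le> real a * real b" using ab by (intro mult_left_mono) auto
      hence "real a \<le> T" using abT by simp
      hence aM: "a \<in> {1..M}" using ab by (auto simp: M_def le_nat_floor)
      have "real b \<le> T / real a" using abT ab by (simp add: field_simps)
      hence b1: "b \<le> nat \<lfloor>T / real a\<rfloor>" by (simp add: le_nat_floor)
      \<comment> \<open>As \<open>k < n\<close> and \<open>r < n\<close>, the centre
        \<open>l n / t\<close> cannot lie beyond \<open>n\<close>; this gives
        \<open>l \<le> t\<close>, the first bound in \<open>Lm\<close>.\<close>
      have "real b * real n \<le> real k * real a + r" using lin by linarith
      also have "real k * real a \<le> real n * real a" using k by (intro mult_right_mono) auto
      finally have "real b * real n < (real a + 1) * real n" using rn n0 by (simp add: algebra_simps)
      hence "b \<le> a" using n0 by simp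
      hence bL: "b \<in> {1..Lm a}" using b1 ab by (simp add: Lm_def)
      have "\<bar>real k - real b * real n / real a\<bar> = \<bar>real b * real n - real k * real a\<bar> / real a"
      proof -
        have "real k - real b * real n / real a = - ((real b * real n - real k * real a) / real a)"
          using ab by (simp add: field_simps)
        thus ?thesis using ab by (simp only: abs_minus_cancel abs_divide abs_of_nat)
      qed
      also have "\<dots> \<le> r / real a" using lin by (intro divide_right_mono) auto
      finally have "k \<in> K a b" by (simp add: K_def)
      thus ?thesis using aM bL by blast
    qed
  qed
  have finK: "finite (K t l)" and cardK: "real (card (K t l)) \<le> 2 * (r / real t) + 1" for t l
    unfolding K_def using r by (intro card_nat_near_le; simp)+
  have "real (card S) \<le> real (card (A \<union> (\<Union>t\<in>{1..M}. \<Union>l\<in>{1..Lm t}. K t l)))"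
    using sub finK by (intro of_nat_mono card_mono) (auto simp: A_def)
  also have "\<dots> \<le> real (card A + (\<Sum>t\<in>{1..M}. \<Sum>l\<in>{1..Lm t}. card (K t l)))"
    by (intro of_nat_mono order_trans[OF card_Un_le] add_left_mono order_trans[OF card_UN_le] sum_mono) auto
  finally have card_S: "real (card S) \<le> real (card A) + (\<Sum>t\<in>{1..M}. \<Sum>l\<in>{1..Lm t}. real (card (K t l)))" by simp
  have card_A: "real (card A) \<le> r / 2"
    using of_nat_floor[of "r / 2"] r(1) by (simp add: A_def)
  have "(\<Sum>t\<in>{1..M}. \<Sum>l\<in>{1..Lm t}. real (card (K t l))) \<le> (\<Sum>t\<in>{1..M}. 21/10 * r * min 1 ((sqrt T)\<^sup>2 / (real t)\<^sup>2))"
  proof (rule sum_mono)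
    fix t assume t: "t \<in> {1..M}"
    hence t1: "real t \<ge> 1" by simp
    have "real t \<le> real M" using t by simp
    also have "\<dots> \<le> T" using T0 by (simp add: M_def)
    finally have "real t \<le> r / 10" using T_le by linarith
    hence "1 \<le> r / (10 * real t)" using t1 by (simp add: field_simps)
    \<comment> \<open>The rounding term 1 is absorbed because \<open>t \<le> r / 10\<close>. With at
      most \<open>min t (T / t)\<close> values of \<open>l\<close>, each \<open>t\<close>
      contributes at most \<open>21/10 * r * min 1 (T / t^2)\<close>.\<close>
    hence w: "2 * (r / real t) + 1 \<le> 21/10 * (r / real t)" using t1 by (simp add: field_simps)
    have "real (Lm t) \<le> min (real t) (T / real t)"
    proof -
      have "real (nat \<lfloor>T / real t\<rfloor>) \<le> T / real t" using T0 by (intro of_nat_floor) simp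
      moreover have "real (Lm t) \<le> real (nat \<lfloor>T / real t\<rfloor>)" by (simp add: Lm_def)
      ultimately show ?thesis by (simp add: Lm_def)
    qed
    also have "\<dots> = real t * min 1 (T / (real t)\<^sup>2)"
      using t1 by (simp add: min_mult_distrib_left power2_eq_square)
    finally have L: "real (Lm t) \<le> real t * min 1 (T / (real t)\<^sup>2)" .
    have "(\<Sum>l\<in>{1..Lm t}. real (card (K t l))) \<le> (\<Sum>l\<in>{1..Lm t}. 21/10 * (r / real t))"
      by (intro sum_mono order_trans[OF cardK w])
    also have "\<dots> = real (Lm t) * (21/10 * (r / real t))" by simp
    also have "\<dots> \<le> (real t * min 1 (T / (real t)\<^sup>2)) * (21/10 * (r / real t))"
      using L r t1 by (intro mult_right_mono) auto
    also have "\<dots> = 21/10 * r * min 1 ((sqrt T)\<^sup>2 / (real t)\<^sup>2)" using t1 T0 by simp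
    finally show "(\<Sum>l\<in>{1..Lm t}. real (card (K t l))) \<le> 21/10 * r * min 1 ((sqrt T)\<^sup>2 / (real t)\<^sup>2)" .
  qed
  also have "\<dots> = 21/10 * r * (\<Sum>t=1..M. min 1 ((sqrt T)\<^sup>2 / (real t)\<^sup>2))" by (simp only: sum_distrib_left)
  also have "\<dots> \<le> 21/10 * r * (2 * sqrt T)"
    using r T0 by (intro mult_left_mono sum_min_1_inverse_squares_le) auto
  also have "\<dots> \<le> 21/10 * r * (2 * (106/100 * r * h\<^sup>2))"
    using sqrtT r by (intro mult_left_mono) auto
  also have "\<dots> = 21/10 * 2 * (106/100) * (D * h\<^sup>2)" by (simp add: power2_eq_square flip: r(2))
  also have "\<dots> \<le> 9/2 * (D * h\<^sup>2)" using D(1) by (intro mult_right_mono) auto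
  finally have "(\<Sum>t\<in>{1..M}. \<Sum>l\<in>{1..Lm t}. real (card (K t l))) \<le> 9/2 * D * h\<^sup>2" by simp
  thus ?thesis using card_S card_A unfolding S_def r_def by linarith
qed

text \<open>For \<open>l = 0\<close>, \<open>t\<close> is even and both terms are at least 4;
  \<open>k = 1\<close>, \<open>t = 2\<close> attains 8. For \<open>l \<noteq> 0\<close>, either
  \<open>k t^2 \<ge> 8\<close>, or \<open>\<bar>k t\<bar> \<le> 7\<close> and the second term is at
  least \<open>3^2\<close> because \<open>n \<ge> 10\<close>.\<close>

lemma resonance_form_ge_8:
  fixes t l :: int
  assumes tl: "t \<noteq> 0" "even (t - l)" and k: "1 \<le> k" and n: "n \<ge> 10"
  shows "real k * (of_int t)\<^sup>2 + (of_int l * real n - real k * of_int t)\<^sup>2 \<ge> 8"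
proof -
  have k1: "int k \<ge> 1" using k by simp
  have t1: "\<bar>t\<bar> \<ge> 1" using tl by simp
  have sq: "\<bar>t\<bar> * 1 \<le> \<bar>t\<bar> * \<bar>t\<bar>" using t1 by (intro mult_left_mono) auto
  have "8 \<le> int k * t\<^sup>2 + (l * int n - int k * t)\<^sup>2"
  proof (cases "l = 0")
    case True
    hence "even t" using tl by simp
    hence "\<bar>t\<bar> \<ge> 2" using tl(1) by presburger
    hence "2 * 2 \<le> \<bar>t\<bar> * \<bar>t\<bar>" by (intro mult_mono) auto
    hence t4: "4 \<le> t\<^sup>2" by (simp add: power2_eq_square)
    have "1 * 4 \<le> int k * t\<^sup>2" using k1 t4 by (intro mult_mono) auto
    moreover have "1 * 1 \<le> int k * int k" using k1 by (intro mult_mono) auto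
    hence "1 * 4 \<le> (int k * int k) * t\<^sup>2" using t4 by (intro mult_mono) auto
    ultimately show ?thesis using True by (simp add: power2_eq_square algebra_simps)
  next
    case False
    show ?thesis
    proof (cases "int k * t\<^sup>2 \<ge> 8")
      case True
      thus ?thesis using zero_le_power2[of "l * int n - int k * t"] by linarith
    next
      case kt: False
      have "\<bar>int k * t\<bar> = int k * \<bar>t\<bar>" by (simp add: abs_mult)
      also have "\<dots> \<le> int k * t\<^sup>2" using sq by (intro mult_left_mono) (auto simp: power2_eq_square)
      finally have "\<bar>int k * t\<bar> \<le> 7" using kt by simp
      moreover have "1 * int n \<le> \<bar>l\<bar> * int n" using False by (intro mult_right_mono) auto
      moreover have "\<bar>l * int n\<bar> = \<bar>l\<bar> * int n" by (simp add: abs_mult)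
      ultimately have "\<bar>l * int n - int k * t\<bar> \<ge> 3" using n by linarith
      hence "3 * 3 \<le> \<bar>l * int n - int k * t\<bar> * \<bar>l * int n - int k * t\<bar>" by (intro mult_mono) auto
      moreover have "0 \<le> int k * t\<^sup>2" by simp
      ultimately show ?thesis unfolding power2_eq_square[of "l * int n - int k * t"] abs_mult_self_eq by linarith
    qed
  qed
  hence "real_of_int 8 \<le> real_of_int (int k * t\<^sup>2 + (l * int n - int k * t)\<^sup>2)" by (simp only: of_int_le_iff)
  thus ?thesis by simp
qed

section \<open>From the resonance form to the gap\<close>

text \<open>The root found in \<open>exists_root_near_1\<close> shows that there are eigenvalues
  other than 1, so the gap is attained at some root, to which \<open>root_lattice_point\<close>
  applies.\<close>

lemma gap_resonance:
  fixes h :: real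
  assumes k: "1 \<le> k" "k < n" and h: "0 < h" "h \<le> 1/1000" "real n * h ^ 4 = 1"
    and gap: "gap n k \<le> h ^ 6"
  obtains t l :: int where "t \<noteq> 0" "even (t - l)"
    and "pi\<^sup>2 * (real k * (of_int t)\<^sup>2 + (of_int l * real n - real k * of_int t)\<^sup>2)
      \<le> 2 * real n ^ 3 * gap n k * (1 + 9000 * h)"
proof -
  have "\<exists>z::complex. (2 * z ^ (n - k) - 1) * (2 * z - 1) ^ k = 1 \<and> z \<noteq> 1"
    using exists_root_near_1[OF k h] by blast
  then obtain z :: complex where z: "(2 * z ^ (n - k) - 1) * (2 * z - 1) ^ k = 1" "z \<noteq> 1"
    and gz: "gap n k = 1 - norm z" by (rule gap_attained[OF k])
  have "1 - norm z \<le> h ^ 6" using gap gz by simp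
  then obtain t l :: int where "t \<noteq> 0" "even (t - l)"
    and "pi\<^sup>2 * (real k * (of_int t)\<^sup>2 + (of_int l * real n - real k * of_int t)\<^sup>2)
      \<le> 2 * real n ^ 3 * (1 - norm z) * (1 + 9000 * h)"
    by (rule root_lattice_point[OF z k h])
  thus ?thesis unfolding gz[symmetric] by (rule that)
qed

text \<open>The minimum 8 of the form gives
  \<open>8 * pi^2 \<le> 2 * n^3 * gap * (1 + 9000 * h)\<close>, and \<open>h^12\<close> is
  \<open>n^(-3)\<close>.\<close>

lemma gap_ge_cubic:
  fixes h :: real
  assumes k: "1 \<le> k" "k < n" and h: "0 < h" "h \<le> 1/1000" "real n * h ^ 4 = 1" and n: "n \<ge> 10"
  shows "gap n k \<ge> 4 * pi\<^sup>2 / (1 + 9000 * h) * h ^ 12"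
proof (cases "gap n k \<le> h ^ 6")
  case True
  then obtain t l :: int where tl: "t \<noteq> 0" "even (t - l)"
    and le: "pi\<^sup>2 * (real k * (of_int t)\<^sup>2 + (of_int l * real n - real k * of_int t)\<^sup>2)
      \<le> 2 * real n ^ 3 * gap n k * (1 + 9000 * h)" by (rule gap_resonance[OF k h])
  have "pi\<^sup>2 * 8 \<le> pi\<^sup>2 * (real k * (of_int t)\<^sup>2 + (of_int l * real n - real k * of_int t)\<^sup>2)"
    by (intro mult_left_mono resonance_form_ge_8 tl k n) simp
  hence "pi\<^sup>2 * 8 \<le> 2 * real n ^ 3 * gap n k * (1 + 9000 * h)" using le by linarith
  hence "(pi\<^sup>2 * 8) * h ^ 12 \<le> (2 * real n ^ 3 * gap n k * (1 + 9000 * h)) * h ^ 12"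
    using h by (intro mult_right_mono) auto
  also have "\<dots> = 2 * (real n * h ^ 4) ^ 3 * (gap n k * (1 + 9000 * h))"
    by (simp add: power_mult_distrib)
  finally have "4 * pi\<^sup>2 * h ^ 12 \<le> gap n k * (1 + 9000 * h)" unfolding h(3) by simp
  thus ?thesis using h by (simp add: field_simps)
next
  \<comment> \<open>A gap above \<open>h^6\<close> is far larger than the claimed bound of order
    \<open>h^12\<close>.\<close>
  case False
  have p: "pi\<^sup>2 \<le> 16" using power_mono[of pi 4 2] pi_less_4 by simp
  have "h ^ 6 \<le> (1/1000) ^ 6" using h by (intro power_mono) auto
  hence "h ^ 6 \<le> 1 / 64" by (rule order_trans) (simp add: power_divide)
  have "4 * pi\<^sup>2 / (1 + 9000 * h) \<le> 4 * pi\<^sup>2 / 1" using h by (intro divide_left_mono) auto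
  hence "4 * pi\<^sup>2 / (1 + 9000 * h) \<le> 64" using p by simp
  hence "4 * pi\<^sup>2 / (1 + 9000 * h) * (h ^ 6 * h ^ 6) \<le> 64 * ((1 / 64) * h ^ 6)"
    using h \<open>h ^ 6 \<le> 1 / 64\<close> by (intro mult_mono) auto
  thus ?thesis using False by (simp flip: power_add)
qed

text \<open>A gap below the threshold makes the form at most \<open>D = \<delta> / (8 h^6)\<close>
  at some admissible \<open>(t, l)\<close>, so the exceptional \<open>k\<close> are counted by
  \<open>card_near_resonant_le\<close>. For \<open>\<delta> \<ge> 1\<close> the bound exceeds
  \<open>n\<close> already.\<close>

lemma card_small_gap_le:
  fixes h \<delta> :: real
  assumes h: "0 < h" "h \<le> 1/1000" "real n * h ^ 4 = 1" and \<delta>: "\<delta> > 0"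
  shows "real (card {k \<in> {1..<n}. gap n k < pi\<^sup>2 / 16 / (1 + 9000 * h) * \<delta> * h ^ 6})
    \<le> \<delta> powr (2 / 3) * real n"
proof -
  define S where "S = {k \<in> {1..<n}. gap n k < pi\<^sup>2 / 16 / (1 + 9000 * h) * \<delta> * h ^ 6}"
  have "real (card S) \<le> \<delta> powr (2 / 3) * real n"
  proof (cases "\<delta> \<ge> 1")
    case True
    have "card S \<le> card {1..<n}" unfolding S_def by (intro card_mono) auto
    hence "real (card S) \<le> 1 * real n" by simp
    also have "\<dots> \<le> \<delta> powr (2 / 3) * real n"
      using True by (intro mult_right_mono) (auto simp: ge_one_powr_ge_zero)
    finally show ?thesis .
  next
    case False
    hence \<delta>1: "\<delta> < 1" by simp
    define D where "D = \<delta> / (8 * h ^ 6)"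
    define S' where "S' = {k\<in>{1..<n}. \<exists>t l::int. t \<noteq> 0 \<and> even (t - l) \<and>
      real k * (of_int t)\<^sup>2 + (of_int l * real n - real k * of_int t)\<^sup>2 \<le> D}"
    have "S \<subseteq> S'"
    proof
      fix k assume kS: "k \<in> S"
      hence k: "1 \<le> k" "k < n" and g: "gap n k < pi\<^sup>2 / 16 / (1 + 9000 * h) * \<delta> * h ^ 6"
        by (auto simp: S_def)
      have p: "pi\<^sup>2 / 16 \<le> 1" using power_mono[of pi 4 2] pi_less_4 by simp
      have "pi\<^sup>2 / 16 / (1 + 9000 * h) \<le> 1 / 1" using h p by (intro frac_le) auto
      hence "pi\<^sup>2 / 16 / (1 + 9000 * h) * \<delta> * h ^ 6 \<le> 1 * 1 * h ^ 6"
        using \<delta> \<delta>1 h by (intro mult_mono) auto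
      hence "gap n k \<le> h ^ 6" using g by simp
      then obtain t l :: int where tl: "t \<noteq> 0" "even (t - l)"
        and le: "pi\<^sup>2 * (real k * (of_int t)\<^sup>2 + (of_int l * real n - real k * of_int t)\<^sup>2)
          \<le> 2 * real n ^ 3 * gap n k * (1 + 9000 * h)" by (rule gap_resonance[OF k h])
      have "2 * real n ^ 3 * gap n k * (1 + 9000 * h)
          \<le> 2 * real n ^ 3 * (pi\<^sup>2 / 16 / (1 + 9000 * h) * \<delta> * h ^ 6) * (1 + 9000 * h)"
        using g h by (intro mult_right_mono mult_left_mono) auto
      also have "\<dots> = pi\<^sup>2 * (real n ^ 3 * \<delta> * h ^ 6 / 8)" using h by (simp add: field_simps)
      also have "real n ^ 3 * \<delta> * h ^ 6 / 8 = D"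
      proof -
        have "(real n * h ^ 4) ^ 3 = 1" using h(3) by simp
        hence "real n ^ 3 * h ^ 12 = 1" by (simp add: power_mult_distrib)
        moreover have h12: "h ^ 12 = h ^ 6 * h ^ 6" by (simp flip: power_add)
        have cancel: "x * \<delta> * a / 8 = (x * (a * a)) * (\<delta> / (8 * a))" if "a \<noteq> 0" for x a :: real
          using that by simp
        have "real n ^ 3 * \<delta> * h ^ 6 / 8 = (real n ^ 3 * h ^ 12) * D"
          unfolding h12 D_def by (rule cancel) (use h(1) in simp)
        ultimately show ?thesis by simp
      qed
      finally have "pi\<^sup>2 * (real k * (of_int t)\<^sup>2 + (of_int l * real n - real k * of_int t)\<^sup>2) \<le> pi\<^sup>2 * D"
        using le by linarith
      hence "real k * (of_int t)\<^sup>2 + (of_int l * real n - real k * of_int t)\<^sup>2 \<le> D"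
        by (rule mult_left_le_imp_le) simp
      thus "k \<in> S'" using k tl unfolding S'_def by auto
    qed
    hence "card S \<le> card S'" unfolding S'_def by (intro card_mono) auto
    moreover have "real (card S') \<le> \<delta> powr (2 / 3) * real n"
    proof (cases "D \<ge> 1")
      \<comment> \<open>The form is at least \<open>k * t^2 \<ge> 1\<close>, so no \<open>k\<close>
        qualifies.\<close>
      case False
      have "S' = {}"
      proof (rule ccontr)
        assume "S' \<noteq> {}"
        then obtain k t l where k: "1 \<le> k" and t: "(t::int) \<noteq> 0"
          and le: "real k * (of_int t)\<^sup>2 + (of_int l * real n - real k * of_int t)\<^sup>2 \<le> D"
          unfolding S'_def by auto
        have "1 * 1 \<le> \<bar>t\<bar> * \<bar>t\<bar>" using t by (intro mult_mono) auto
        hence "1 \<le> t\<^sup>2" by (simp add: power2_eq_square)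
        hence "real_of_int 1 \<le> real_of_int (t\<^sup>2)" by (simp only: of_int_le_iff)
        hence "1 * 1 \<le> real k * (of_int t)\<^sup>2" using k by (intro mult_mono) auto
        thus False using le False zero_le_power2[of "of_int l * real n - real k * of_int t"] by linarith
      qed
      thus ?thesis by simp
    next
      case True
      define d where "d = \<delta> powr (1 / 3)"
      have d: "d > 0" "d \<le> 1" using \<delta> \<delta>1 by (auto simp: d_def powr_le1)
      have d3: "d ^ 3 = \<delta>" using \<delta> by (simp add: d_def powr_power)
      have d2: "d ^ 2 = \<delta> powr (2 / 3)" using \<delta> by (simp add: d_def powr_power)
      \<comment> \<open>Chosen so that \<open>D = q^3\<close> and the target
        \<open>\<delta> powr (2/3) * n\<close> is \<open>4 * q^2\<close>; both terms of the count
        are then multiples of \<open>q^2\<close>, as \<open>q \<ge> 1\<close> and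
        \<open>d \<le> 1\<close>.\<close>
      define q where "q = d / (2 * h\<^sup>2)"
      have q0: "q > 0" using d h by (simp add: q_def)
      have D_q: "D = q ^ 3" by (simp add: D_def q_def power_divide power_mult_distrib d3)
      have q1: "q \<ge> 1" 
      proof (rule ccontr)
        assume "\<not> q \<ge> 1"
        hence "q ^ 3 < 1" using q0 power_less_one_iff[of q 3] by simp
        thus False using True D_q by simp
      qed
      have "real (card S') \<le> sqrt D / 2 + 9/2 * D * h\<^sup>2"
        unfolding S'_def using True h \<delta>1 \<delta> by (intro card_near_resonant_le) (auto simp: D_def)
      also have "sqrt D \<le> q\<^sup>2"
      proof (rule real_le_lsqrt)
        have "q ^ 3 \<le> q ^ 4" using q1 by (intro power_increasing) auto
        thus "D \<le> (q\<^sup>2)\<^sup>2" by (simp add: D_q)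
      qed simp
      also have "9/2 * D * h\<^sup>2 = 9/4 * (q\<^sup>2 * d)"
        using h by (simp add: D_q q_def power2_eq_square power3_eq_cube)
      also have "q\<^sup>2 * d \<le> q\<^sup>2 * 1" using d by (intro mult_left_mono) auto
      finally have "real (card S') \<le> 4 * q\<^sup>2" using zero_le_power2[of q] by simp
      also have "4 * q\<^sup>2 = d\<^sup>2 / h ^ 4" by (simp add: q_def power_divide power_mult_distrib)
      also have "\<dots> = d\<^sup>2 * real n" using h by (simp add: field_simps)
      finally show ?thesis by (simp add: d2)
    qed
    ultimately show ?thesis by linarith
  qed
  thus ?thesis by (simp add: S_def)
qed

section \<open>Error terms uniform in \<open>k\<close>\<close>

text \<open>The finitely many small \<open>n\<close> have finitely many \<open>k\<close> each, so
  there the error can be redefined as the largest excess over \<open>c\<close> without changing its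
  limit. For \<open>n \<le> 1\<close> the maximum is over the empty set, but then there is no
  \<open>k\<close> to bound.\<close>

lemma uniform_error_term:
  fixes f :: "nat \<Rightarrow> nat \<Rightarrow> real" and b :: "nat \<Rightarrow> real"
  assumes b: "b \<longlonglongrightarrow> 0"
    and le: "\<forall>\<^sub>F n in sequentially. \<forall>k. 1 \<le> k \<and> k < n \<longrightarrow> f n k \<le> c + b n"
  shows "\<exists>e. e \<longlonglongrightarrow> 0 \<and> (\<forall>n k. 1 \<le> k \<and> k < n \<longrightarrow> f n k \<le> c + e n)"
proof -
  from le obtain N where N: "\<And>n k. n \<ge> N \<Longrightarrow> 1 \<le> k \<Longrightarrow> k < n \<Longrightarrow> f n k \<le> c + b n"
    unfolding eventually_sequentially by blast
  define e where "e = (\<lambda>n. if n \<ge> N then b n else Max ((\<lambda>k. f n k - c) ` {1..<n}))"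
  have "e \<longlonglongrightarrow> 0"
  proof (rule Lim_transform_eventually[OF b])
    show "\<forall>\<^sub>F n in sequentially. b n = e n"
      unfolding eventually_sequentially by (intro exI[of _ N]) (simp add: e_def)
  qed
  moreover have "f n k \<le> c + e n" if "1 \<le> k" "k < n" for n k
  proof (cases "n \<ge> N")
    case True
    thus ?thesis using N[OF True that] by (simp add: e_def)
  next
    case False
    have "f n k - c \<le> Max ((\<lambda>k. f n k - c) ` {1..<n})" using that by (intro Max_ge) auto
    thus ?thesis using False by (simp add: e_def)
  qed
  ultimately show ?thesis by blast
qed

theorem theorem2:
  shows "\<exists>e1 e2 e3 :: nat \<Rightarrow> real.
    e1 \<longlonglongrightarrow> 0 \<and> e2 \<longlonglongrightarrow> 0 \<and> e3 \<longlonglongrightarrow> 0 \<and>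
    (\<forall>n k :: nat. 1 \<le> k \<and> k < n \<longrightarrow>
       gap n k \<le> (2 * pi\<^sup>2 + e1 n) * real n powr (- 3 / 2)) \<and>
    (\<forall>n k :: nat. 1 \<le> k \<and> k < n \<longrightarrow>
       gap n k \<ge> (4 * pi\<^sup>2 + e2 n) * real n powr (- 3)) \<and>
    (\<exists>N :: nat. \<forall>n \<ge> N. \<forall>\<delta> :: real. \<delta> > 0 \<longrightarrow>
       real (card {k \<in> {1..<n}.
           \<not> gap n k \<ge> (pi\<^sup>2 / 16 + e3 n) * \<delta> * real n powr (- 3 / 2)})
         \<le> \<delta> powr (2 / 3) * real n)"
proof -
  define h where "h = (\<lambda>n::nat. real n powr (- 1 / 4))"
  have h_lim: "h \<longlonglongrightarrow> 0" unfolding h_def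
    by (rule tendsto_neg_powr) (auto simp: filterlim_real_sequentially)
  have h6: "h n ^ 6 = real n powr (- 3 / 2)" and h12: "h n ^ 12 = real n powr (- 3)" if "n > 0" for n
    using that by (simp_all add: h_def powr_power)
  have h4: "real n * h n ^ 4 = 1" if "n > 0" for n
  proof -
    have "h n ^ 4 = real n powr (- 1)" using that by (simp add: h_def powr_power)
    thus ?thesis using that by (simp add: powr_minus)
  qed
  have "\<forall>\<^sub>F n in sequentially. h n < 1/1000" using h_lim by (rule order_tendstoD) simp
  then obtain N0 where N0: "\<And>n. n \<ge> N0 \<Longrightarrow> h n < 1/1000" unfolding eventually_sequentially by blast
  define N where "N = max N0 10"
  have h: "0 < h n" "h n \<le> 1/1000" "real n * h n ^ 4 = 1" and n10: "n \<ge> 10" if "n \<ge> N" for n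
    using N0[of n] h4[of n] that by (auto simp: N_def h_def)
  have pos: "real n powr a > 0" if "k < n" for n k :: nat and a using that by simp
  have "\<exists>e. e \<longlonglongrightarrow> 0 \<and>
    (\<forall>n k. 1 \<le> k \<and> k < n \<longrightarrow> gap n k / real n powr (- 3 / 2) \<le> 2 * pi\<^sup>2 + e n)"
  proof (rule uniform_error_term)
    show "(\<lambda>n. 6000 * h n) \<longlonglongrightarrow> 0" using tendsto_mult_left[OF h_lim, of 6000] by simp
    show "\<forall>\<^sub>F n in sequentially. \<forall>k. 1 \<le> k \<and> k < n \<longrightarrow>
        gap n k / real n powr (- 3 / 2) \<le> 2 * pi\<^sup>2 + 6000 * h n"
      unfolding eventually_sequentially
    proof (intro exI[of _ N] allI impI)
      fix n k assume n: "N \<le> n" and "1 \<le> k \<and> k < n"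
      hence k: "1 \<le> k" "k < n" by auto
      obtain z :: complex where "(2 * z ^ (n - k) - 1) * (2 * z - 1) ^ k = 1" "z \<noteq> 1"
        and z: "1 - norm z \<le> (2 * pi\<^sup>2 + 6000 * h n) * h n ^ 6"
        by (rule exists_root_near_1[OF k h[OF n]])
      hence "gap n k \<le> (2 * pi\<^sup>2 + 6000 * h n) * h n ^ 6"
        using gap_le_root[OF k] order_trans by blast
      thus "gap n k / real n powr (- 3 / 2) \<le> 2 * pi\<^sup>2 + 6000 * h n"
        using k pos[of k n "- 3 / 2"] by (simp add: h6 pos_divide_le_eq)
    qed
  qed
  then obtain e1 where e1: "e1 \<longlonglongrightarrow> 0"
    "\<And>n k. 1 \<le> k \<Longrightarrow> k < n \<Longrightarrow> gap n k / real n powr (- 3 / 2) \<le> 2 * pi\<^sup>2 + e1 n"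
    by blast
  have inv_lim: "(\<lambda>n. c / (1 + 9000 * h n) - c) \<longlonglongrightarrow> 0" for c :: real
  proof -
    have "(\<lambda>n. c / (1 + 9000 * h n) - c) \<longlonglongrightarrow> c / (1 + 9000 * 0) - c"
      by (intro tendsto_intros h_lim) auto
    thus ?thesis by simp
  qed
  \<comment> \<open>The lower bound is stated as an upper bound for the negated quotient so that
    \<open>uniform_error_term\<close> applies; the error term is negated back at the end.\<close>
  have "\<exists>e. e \<longlonglongrightarrow> 0 \<and>
    (\<forall>n k. 1 \<le> k \<and> k < n \<longrightarrow> - (gap n k / real n powr (- 3)) \<le> - (4 * pi\<^sup>2) + e n)"
  proof (rule uniform_error_term)
    show "(\<lambda>n. - (4 * pi\<^sup>2 / (1 + 9000 * h n) - 4 * pi\<^sup>2)) \<longlonglongrightarrow> 0"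
      using tendsto_minus[OF inv_lim[of "4 * pi\<^sup>2"]] by simp
    show "\<forall>\<^sub>F n in sequentially. \<forall>k. 1 \<le> k \<and> k < n \<longrightarrow> - (gap n k / real n powr (- 3))
        \<le> - (4 * pi\<^sup>2) + - (4 * pi\<^sup>2 / (1 + 9000 * h n) - 4 * pi\<^sup>2)"
      unfolding eventually_sequentially
    proof (intro exI[of _ N] allI impI)
      fix n k assume n: "N \<le> n" and "1 \<le> k \<and> k < n"
      hence k: "1 \<le> k" "k < n" by auto
      have "4 * pi\<^sup>2 / (1 + 9000 * h n) * real n powr (- 3) \<le> gap n k"
        using gap_ge_cubic[OF k h[OF n] n10[OF n]] k by (simp add: h12)
      hence "4 * pi\<^sup>2 / (1 + 9000 * h n) \<le> gap n k / real n powr (- 3)"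
        by (subst pos_le_divide_eq[OF pos[OF k(2)]])
      thus "- (gap n k / real n powr (- 3))
          \<le> - (4 * pi\<^sup>2) + - (4 * pi\<^sup>2 / (1 + 9000 * h n) - 4 * pi\<^sup>2)" by simp
    qed
  qed
  then obtain e2 where e2: "e2 \<longlonglongrightarrow> 0"
    "\<And>n k. 1 \<le> k \<Longrightarrow> k < n \<Longrightarrow> - (gap n k / real n powr (- 3)) \<le> - (4 * pi\<^sup>2) + e2 n"
    by blast
  \<comment> \<open>Chosen so that \<open>pi^2 / 16 + e3 n\<close> is exactly the constant in
    \<open>card_small_gap_le\<close>. It depends on \<open>n\<close> alone, hence serves all
    \<open>\<delta>\<close> at once.\<close>
  define e3 where "e3 = (\<lambda>n. pi\<^sup>2 / 16 / (1 + 9000 * h n) - pi\<^sup>2 / 16)"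
  show ?thesis
  proof (intro exI conjI allI impI)
    show "e1 \<longlonglongrightarrow> 0" by (rule e1(1))
    show "(\<lambda>n. - e2 n) \<longlonglongrightarrow> 0" using tendsto_minus[OF e2(1)] by simp
    show "e3 \<longlonglongrightarrow> 0" unfolding e3_def by (rule inv_lim)
  next
    fix n k :: nat assume k: "1 \<le> k \<and> k < n"
    show "gap n k \<le> (2 * pi\<^sup>2 + e1 n) * real n powr (- 3 / 2)"
      using e1(2)[of k n] k pos[of k n "- 3 / 2"] by (simp add: pos_divide_le_eq)
    have "4 * pi\<^sup>2 + - e2 n \<le> gap n k / real n powr (- 3)" using e2(2)[of k n] k by simp
    thus "(4 * pi\<^sup>2 + - e2 n) * real n powr (- 3) \<le> gap n k"
      using k by (subst (asm) pos_le_divide_eq[OF pos]) auto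
  next
    fix n :: nat and \<delta> :: real assume n: "N \<le> n" and \<delta>: "\<delta> > 0"
    have n0: "n > 0" using n10[OF n] by simp
    show "real (card {k \<in> {1..<n}. \<not> (pi\<^sup>2 / 16 + e3 n) * \<delta> * real n powr (- 3 / 2) \<le> gap n k})
        \<le> \<delta> powr (2 / 3) * real n"
      using card_small_gap_le[OF h[OF n] \<delta>] by (simp add: e3_def not_le h6[OF n0])
  qed
qed
end
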